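(* Let $G_1,G_2,G_3$ be finite groups of equal order with subsets $S_i\subset G_i$ such that $S_i=S_i^{-1}$ and $|S_1|=|S_2|=|S_3|=d$. Let $G=G_1\times G_2\times G_3$ and let $H$ be the 3-uniform hypergraph on $G$ whose triples are $\{(s_1,e,e)g,\ (e,s_2,e)g,\ (e,e,s_3)g\}$ for $g\in G$, $s_i\in S_i$. Let $\lambda_i=\lambda(\mathrm{Cay}(G_i,S_i))$, ordered so that $\lambda_1\le\lambda_2\le\lambda_3$. Then the 2D random walk on $H$ converges with rate at most $$\sqrt{\tfrac12+\tfrac12 f\!\left(\tfrac{1+2\lambda_3}{3},\tfrac12\right)},$$ i.e. $\lambda(G_{walk})$ is at most this quantity.
   Context: The skeleton $E^1$ of $H$ is the set of 2-element subsets of triples of $H$. $G_{walk}$ is the graph with vertex set $E^1$, where $\mathcal E\sim\mathcal E'$ iff $\mathcal E\neq\mathcal E'$ and some triple of $H$ contains $\mathcal E\cup\mathcal E'$ (the 2D random walk on $H$ is the simple random walk on $G_{walk}$). For a regular graph, $\lambda(\cdot)$ denotes the largest absolute value of an eigenvalue of its normalized adjacency matrix (adjacency divided by degree) other than the top eigenvalue $1$. $\mathrm{Cay}(G_i,S_i)$ is the Cayley graph with edges $\{g,sg\}$, $s\in S_i$. The zig-zag function is $f(x,y)=\tfrac12(1-y^2)x+\tfrac12\sqrt{(1-y^2)^2x^2+4y^2}$. *)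

theory Defs
  imports
    "HOL-Algebra.Coset"
    "HOL-Library.Countable_Set"
    "Jordan_Normal_Form.Char_Poly"
begin

text \<open>
  A finite graph is given by its vertex set \<open>V\<close> and its edge set \<open>E\<close>, whose members are the
  unordered pairs \<open>{u, v}\<close>; a loop at \<open>v\<close> is the singleton \<open>{v}\<close>.
\<close>

definition degree_in :: "'v set \<Rightarrow> 'v set set \<Rightarrow> 'v \<Rightarrow> nat" where
  "degree_in V E u = card {v \<in> V. {u, v} \<in> E}"

text \<open>
  The rows and columns are numbered by an arbitrary enumeration of the finite set \<open>V\<close>; the
  characteristic polynomial does not depend on it.
\<close>

definition normalized_adjacency_mat :: "'v set \<Rightarrow> 'v set set \<Rightarrow> real mat" where
  "normalized_adjacency_mat V E =
     mat (card V) (card V) (\<lambda>(i, j).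
       of_bool ({from_nat_into V i, from_nat_into V j} \<in> E)
         / real (degree_in V E (from_nat_into V i)))"

text \<open>
  For a regular graph the matrix is symmetric, so the roots of its characteristic polynomial are
  all real and \<open>proots\<close> lists the eigenvalues with multiplicity. Exactly one copy of the top
  eigenvalue \<open>1\<close> is discarded; in particular a disconnected graph has \<open>\<lambda> = 1\<close>. The inserted \<open>0\<close>
  matters only when no eigenvalue remains (at most one vertex), where \<open>\<lambda> = 0\<close>.
\<close>

definition graph_lambda :: "'v set \<Rightarrow> 'v set set \<Rightarrow> real" where
  "graph_lambda V E =
     Max (insert 0 (abs ` set_mset (proots (char_poly (normalized_adjacency_mat V E)) - {#1#})))"

definition cayley_edges :: "('a, 'm) monoid_scheme \<Rightarrow> 'a set \<Rightarrow> 'a set set" where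
  "cayley_edges G S = {{g, s \<otimes>\<^bsub>G\<^esub> g} | g s. g \<in> carrier G \<and> s \<in> S}"

definition cayley_lambda :: "('a, 'm) monoid_scheme \<Rightarrow> 'a set \<Rightarrow> real" where
  "cayley_lambda G S = graph_lambda (carrier G) (cayley_edges G S)"

definition uniform_hypergraph :: "nat \<Rightarrow> 'v set \<Rightarrow> 'v set set \<Rightarrow> bool" where
  "uniform_hypergraph k V H \<longleftrightarrow> (\<forall>T \<in> H. T \<subseteq> V \<and> card T = k)"

text \<open>
  Two of the three points below coincide exactly when the identity lies in two of the sets used, so
  3-uniformity says (for nonempty \<open>S1\<close>, \<open>S2\<close>, \<open>S3\<close>) that at most one of them contains the identity.
\<close>

definition product_hypergraph ::
  "('a, 'm) monoid_scheme \<Rightarrow> ('b, 'n) monoid_scheme \<Rightarrow> ('c, 'k) monoid_scheme \<Rightarrow>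
   'a set \<Rightarrow> 'b set \<Rightarrow> 'c set \<Rightarrow> ('a \<times> 'b \<times> 'c) set set" where
  "product_hypergraph G1 G2 G3 S1 S2 S3 =
     {{(s1, \<one>\<^bsub>G2\<^esub>, \<one>\<^bsub>G3\<^esub>) \<otimes>\<^bsub>G1 \<times>\<times> G2 \<times>\<times> G3\<^esub> g,
       (\<one>\<^bsub>G1\<^esub>, s2, \<one>\<^bsub>G3\<^esub>) \<otimes>\<^bsub>G1 \<times>\<times> G2 \<times>\<times> G3\<^esub> g,
       (\<one>\<^bsub>G1\<^esub>, \<one>\<^bsub>G2\<^esub>, s3) \<otimes>\<^bsub>G1 \<times>\<times> G2 \<times>\<times> G3\<^esub> g} | g s1 s2 s3.
      g \<in> carrier (G1 \<times>\<times> G2 \<times>\<times> G3) \<and> s1 \<in> S1 \<and> s2 \<in> S2 \<and> s3 \<in> S3}"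

definition skeleton :: "'v set set \<Rightarrow> 'v set set" where
  "skeleton H = {e. card e = 2 \<and> (\<exists>T \<in> H. e \<subseteq> T)}"

definition walk_edges :: "'v set set \<Rightarrow> 'v set set set" where
  "walk_edges H =
     {{e, e'} | e e'. e \<in> skeleton H \<and> e' \<in> skeleton H \<and> e \<noteq> e' \<and> (\<exists>T \<in> H. e \<union> e' \<subseteq> T)}"

definition walk_lambda :: "'v set set \<Rightarrow> real" where
  "walk_lambda H = graph_lambda (skeleton H) (walk_edges H)"

definition zigzag_fun :: "real \<Rightarrow> real \<Rightarrow> real" where
  "zigzag_fun x y =
     1 / 2 * (1 - y\<^sup>2) * x + 1 / 2 * sqrt ((1 - y\<^sup>2)\<^sup>2 * x\<^sup>2 + 4 * y\<^sup>2)"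

end

theory Submission
  imports Defs "HOL-Analysis.Function_Topology"
begin

text \<open>
  For \<open>g \<in> G\<close> the triples obtained from \<open>g\<close> are the triangles of a complete tripartite graph \<open>K\<^sub>d\<^sub>,\<^sub>d\<^sub>,\<^sub>d\<close>,
  the cloud of \<open>g\<close>, and every edge of the skeleton lies in exactly two clouds. So functions on the
  skeleton are the functions on \<open>X = G \<times> E(K\<^sub>d\<^sub>,\<^sub>d\<^sub>,\<^sub>d)\<close> invariant under an involution \<open>R\<close> of \<open>X\<close>, and the 2D walk
  becomes \<open>P M P\<close> with \<open>P = (1 + R) / 2\<close> and \<open>M\<close> the walk inside the clouds. Inside a cloud all
  eigenvalues but the top one are at most \<open>1/2\<close> in absolute value, while \<open>R\<close> moves a random point of
  the cloud of \<open>(a, b, c)\<close> to that of \<open>(s\<^sub>1a, s\<^sub>2b, c)\<close>, \<open>(s\<^sub>1a, b, s\<^sub>3c)\<close> or \<open>(a, s\<^sub>2b, s\<^sub>3c)\<close>, a walk on \<open>G\<close>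
  with second eigenvalue at most \<open>(1 + 2\<lambda>\<^sub>3) / 3\<close>. Since \<open>R\<close> is a reflection, the
  Reingold--Vadhan--Wigderson estimate bounds \<open>\<langle>M x, R M x\<rangle>\<close> by \<open>f((1 + 2\<lambda>\<^sub>3) / 3, 1/2) |x|\<^sup>2\<close> for \<open>x\<close>
  orthogonal to the constants, and \<open>|P M x|\<^sup>2 = (|M x|\<^sup>2 + \<langle>M x, R M x\<rangle>) / 2\<close>.
\<close>

section \<open>Spectra of regular graphs\<close>

text \<open>\<open>graph_lambda\<close> is defined through roots of a characteristic polynomial,
  whereas the estimates need operator norms on functions with sum zero. A maximizer of |A f|^2 on
  the unit sphere links the two: it yields an eigenvalue whose absolute value is the norm. The
  number (1 + 2 c) / 3, with c the largest \<lambda> of the Cayley graphs, arises because a step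
  between clouds moves two of the three coordinates, so that it is one of three products of two
  commuting averages. On functions with mean zero in one coordinate the two products involving this
  coordinate shrink by c, while the third may not shrink at all. The outer square root appears
  because the estimate controls |P M x|^2. It needs only an upper bound for the form of R, so
  negative eigenvalues of the walk between clouds do no harm. 3-uniformity lets at most one S_i
  contain the identity. This makes the two clouds of an edge distinct and keeps its 4d neighbours
  apart, so that P M P is exactly the walk on a regular graph.\<close>

text \<open>Conjugating by a basis that starts with the all-ones vector splits off one factor \<open>X - 1\<close> of the
  characteristic polynomial; by symmetry, left eigenvectors of the remaining block are the
  eigenvectors of \<open>A\<close> orthogonal to the all-ones vector.\<close>

lemma proots_minus_one_iff_eigenvector_orthogonal_ones:
  fixes A :: "real mat"
  assumes A: "A \<in> carrier_mat n n" and n: "0 < n"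
    and sym: "\<And>i j. i < n \<Longrightarrow> j < n \<Longrightarrow> A $$ (i, j) = A $$ (j, i)"
    and rows: "\<And>i. i < n \<Longrightarrow> (\<Sum>j<n. A $$ (i, j)) = 1"
  shows "\<mu> \<in># proots (char_poly A) - {#1#} \<longleftrightarrow>
    (\<exists>v. (\<exists>i<n. v i \<noteq> 0) \<and> (\<Sum>i<n. v i) = 0 \<and> (\<forall>i<n. (\<Sum>j<n. A $$ (i, j) * v j) = \<mu> * v i))"
proof -
  obtain m where m: "n = Suc m"
    using n by (cases n) auto
  \<comment> \<open>The columns of \<open>P\<close> are the all-ones vector and the standard basis
    vectors except the zeroth. Since the rows of \<open>A\<close> sum to 1, column 0 of
    \<open>A * P\<close> is again all ones, which makes \<open>C\<close> block triangular.\<close>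
  define P :: "real mat" where "P = mat n n (\<lambda>(i, j). if j = 0 then 1 else of_bool (i = j))"
  define Q :: "real mat" where
    "Q = mat n n (\<lambda>(i, j). if j = 0 then (if i = 0 then 1 else - 1) else of_bool (i = j))"
  define B where "B = mat m m (\<lambda>(i, j). A $$ (Suc i, Suc j) - A $$ (0, Suc j))"
  define r where "r = mat 1 m (\<lambda>(i, j). A $$ (0, Suc j))"
  define C where "C = four_block_mat (1\<^sub>m 1) r (0\<^sub>m m 1) B"
  have carr: "P \<in> carrier_mat n n" "Q \<in> carrier_mat n n" "B \<in> carrier_mat m m" "C \<in> carrier_mat n n"
    "r \<in> carrier_mat 1 m"
    unfolding P_def Q_def B_def C_def r_def using m by (auto intro!: four_block_carrier_mat)
  have C_entry: "C $$ (i, j) = (if i = 0 then (if j = 0 then 1 else A $$ (0, j))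
      else if j = 0 then 0 else A $$ (i, j) - A $$ (0, j))" if "i < n" "j < n" for i j
    using that m unfolding C_def r_def B_def by (cases i; cases j) auto
  have sum_split: "(\<Sum>k<n. f k) = f 0 + (\<Sum>k<m. f (Suc k))" for f :: "nat \<Rightarrow> real"
    unfolding m by (rule sum.lessThan_Suc_shift)
  have mult_entry: "(X * Y) $$ (i, j) = (\<Sum>k<n. X $$ (i, k) * Y $$ (k, j))"
    if "X \<in> carrier_mat n n" "Y \<in> carrier_mat n n" "i < n" "j < n" for X Y :: "real mat" and i j
    using that by (auto simp: scalar_prod_def lessThan_atLeast0 intro!: sum.cong)
  have P_mult: "(P * Y) $$ (i, j) = Y $$ (0, j) + (if i = 0 then 0 else Y $$ (i, j))"
    if "Y \<in> carrier_mat n n" "i < n" "j < n" for Y i j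
  proof (cases i)
    case 0
    have "(P * Y) $$ (i, j) = (\<Sum>k<n. if k = 0 then Y $$ (k, j) else 0)"
      using that carr 0 unfolding mult_entry[OF carr(1) that]
      by (intro sum.cong) (auto simp: P_def)
    then show ?thesis using that 0 by simp
  next
    case (Suc i')
    have "(P * Y) $$ (i, j)
        = (\<Sum>k<n. (if k = 0 then Y $$ (k, j) else 0) + (if k = i then Y $$ (k, j) else 0))"
      using that carr Suc unfolding mult_entry[OF carr(1) that]
      by (intro sum.cong) (auto simp: P_def)
    then show ?thesis using that Suc n by (simp add: sum.distrib)
  qed
  have "P * Q = 1\<^sub>m n"
  proof (rule eq_matI)
    fix i j assume "i < dim_row (1\<^sub>m n :: real mat)" "j < dim_col (1\<^sub>m n :: real mat)"
    then show "(P * Q) $$ (i, j) = 1\<^sub>m n $$ (i, j)"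
      using n by (subst P_mult) (auto simp: Q_def)
  qed (use carr in auto)
  moreover from this have "Q * P = 1\<^sub>m n"
    using carr by (rule_tac mat_mult_left_right_inverse)
  moreover have "A * P = P * C"
  proof (rule eq_matI)
    fix i j assume ij: "i < dim_row (P * C)" "j < dim_col (P * C)"
    then have ij: "i < n" "j < n" using carr by auto
    have "(A * P) $$ (i, j) = (if j = 0 then 1 else A $$ (i, j))"
    proof (cases j)
      case 0
      then show ?thesis using ij rows[of i] unfolding mult_entry[OF A carr(1) ij]
        by (simp add: P_def)
    next
      case (Suc j')
      have "(A * P) $$ (i, j) = (\<Sum>k<n. if k = j then A $$ (i, k) else 0)"
        unfolding mult_entry[OF A carr(1) ij] using ij Suc
        by (intro sum.cong) (auto simp: P_def)
      then show ?thesis using ij Suc by simp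
    qed
    moreover have "(P * C) $$ (i, j) = C $$ (0, j) + (if i = 0 then 0 else C $$ (i, j))"
      using ij carr by (intro P_mult)
    ultimately show "(A * P) $$ (i, j) = (P * C) $$ (i, j)"
      using ij n by (auto simp: C_entry)
  qed (use carr A in auto)
  ultimately have PQ: "P * Q = 1\<^sub>m n" "Q * P = 1\<^sub>m n" "A * P = P * C"
    by auto
  have "A = A * (P * Q)"
    using A by (simp add: PQ(1))
  also have "\<dots> = P * C * Q"
    using A carr by (simp add: assoc_mult_mat[symmetric, of A n n P n Q n] PQ(3))
  finally have "A = P * C * Q" .
  with PQ(1,2) have "similar_mat A C"
    using carr A unfolding similar_mat_def similar_mat_wit_def Let_def
    by (intro exI[of _ P] exI[of _ Q]) auto
  then have "char_poly A = char_poly C"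
    by (rule char_poly_similar)
  also have "\<dots> = [:- 1, 1:] * char_poly B"
    unfolding C_def using carr
    by (subst char_poly_four_block_zeros_col[of _ _ m]) (auto simp: char_poly_defs det_single)
  finally have char: "char_poly A = [:- 1, 1:] * char_poly B" .
  have nz: "char_poly B \<noteq> 0"
    using degree_monic_char_poly[OF carr(3)] by auto
  have "proots (char_poly A) - {#1#} = proots (char_poly B)"
    unfolding char using nz by (subst proots_mult) auto
  then have "\<mu> \<in># proots (char_poly A) - {#1#} \<longleftrightarrow> eigenvalue (transpose_mat B) \<mu>"
    using nz carr eigenvalue_root_char_poly[of "transpose_mat B" m \<mu>] by auto
  also have "\<dots> \<longleftrightarrow> (\<exists>w. (\<exists>i<m. w i \<noteq> 0) \<and> (\<forall>j<m. (\<Sum>i<m. B $$ (i, j) * w i) = \<mu> * w j))"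
    (is "_ \<longleftrightarrow> (\<exists>w. ?ev w)")
  proof
    assume "eigenvalue (transpose_mat B) \<mu>"
    then obtain w where w: "w \<in> carrier_vec m" "w \<noteq> 0\<^sub>v m" "transpose_mat B *\<^sub>v w = \<mu> \<cdot>\<^sub>v w"
      using carr unfolding eigenvalue_def eigenvector_def by auto
    have "(\<Sum>i<m. B $$ (i, j) * w $ i) = \<mu> * w $ j" if "j < m" for j
      using arg_cong[OF w(3), of "\<lambda>x. x $ j"] that w(1) carr
      by (auto simp: scalar_prod_def lessThan_atLeast0)
    moreover have "\<exists>i<m. w $ i \<noteq> 0"
    proof (rule ccontr)
      assume "\<not> (\<exists>i<m. w $ i \<noteq> 0)"
      then have "w = 0\<^sub>v m" using w(1) by (intro eq_vecI) auto
      then show False using w(2) by simp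
    qed
    ultimately show "\<exists>w. ?ev w" by blast
  next
    assume "\<exists>w. ?ev w"
    then obtain w where w: "?ev w" by blast
    have "transpose_mat B *\<^sub>v vec m w = \<mu> \<cdot>\<^sub>v vec m w"
      using w carr by (intro eq_vecI) (auto simp: scalar_prod_def lessThan_atLeast0)
    moreover have "vec m w \<noteq> 0\<^sub>v m"
      using w by (metis index_vec index_zero_vec(1))
    ultimately show "eigenvalue (transpose_mat B) \<mu>"
      using carr unfolding eigenvalue_def eigenvector_def by (intro exI[of _ "vec m w"]) auto
  qed
  also have "\<dots> \<longleftrightarrow> (\<exists>v. (\<exists>i<n. v i \<noteq> 0) \<and> (\<Sum>i<n. v i) = 0
      \<and> (\<forall>i<n. (\<Sum>j<n. A $$ (i, j) * v j) = \<mu> * v i))" (is "_ \<longleftrightarrow> (\<exists>v. ?ev' v)")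
  proof -
    have key: "(\<Sum>i<m. B $$ (i, j) * v (Suc i)) = (\<Sum>i<n. A $$ (Suc j, i) * v i)"
      if "(\<Sum>i<n. v i) = 0" "j < m" for v j
    proof -
      have v0: "v 0 = - (\<Sum>i<m. v (Suc i))"
        using that(1) unfolding sum_split by simp
      have "(\<Sum>i<m. B $$ (i, j) * v (Suc i))
          = (\<Sum>i<m. A $$ (Suc i, Suc j) * v (Suc i)) - A $$ (0, Suc j) * (\<Sum>i<m. v (Suc i))"
        using that(2) by (simp add: B_def algebra_simps sum_subtractf sum_distrib_left)
      also have "\<dots> = (\<Sum>i<n. A $$ (Suc j, i) * v i)"
      proof -
        have "A $$ (Suc j, 0) = A $$ (0, Suc j)"
          using that(2) m by (intro sym) auto
        moreover have "(\<Sum>i<m. A $$ (Suc i, Suc j) * v (Suc i)) = (\<Sum>i<m. A $$ (Suc j, Suc i) * v (Suc i))"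
          using that(2) m by (intro sum.cong refl arg_cong2[where f = "(*)"] sym) auto
        ultimately show ?thesis
          unfolding sum_split v0 by simp
      qed
      finally show ?thesis .
    qed
    show ?thesis
    proof
      assume "\<exists>w. ?ev w"
      then obtain w where w: "\<exists>i<m. w i \<noteq> 0"
        "\<And>j. j < m \<Longrightarrow> (\<Sum>i<m. B $$ (i, j) * w i) = \<mu> * w j" by blast
      define v where "v i = (case i of 0 \<Rightarrow> - (\<Sum>i<m. w i) | Suc i \<Rightarrow> w i)" for i
      have v_Suc: "v (Suc i) = w i" and v_0: "v 0 = - (\<Sum>i<m. w i)" for i
        by (auto simp: v_def)
      have sum0: "(\<Sum>i<n. v i) = 0"
        unfolding sum_split by (simp add: v_Suc v_0)
      have Suc_case: "(\<Sum>i<n. A $$ (Suc j, i) * v i) = \<mu> * v (Suc j)" if "j < m" for j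
        using key[OF sum0 that] w(2)[OF that] by (simp add: v_Suc)
      \<comment> \<open>The block \<open>B\<close> gives no equation for row 0. It follows from the
        others: by symmetry the columns of \<open>A\<close> also sum to 1, so \<open>A v\<close> has
        sum zero, as \<open>v\<close> has.\<close>
      have "(\<Sum>i<n. \<Sum>j<n. A $$ (i, j) * v j) = (\<Sum>j<n. (\<Sum>i<n. A $$ (j, i)) * v j)"
        unfolding sum_distrib_right by (subst sum.swap) (intro sum.cong refl arg_cong2[where f = "(*)"] sym; simp)
      also have "\<dots> = 0"
        using rows sum0 by simp
      finally have "(\<Sum>j<n. A $$ (0, j) * v j) = - (\<Sum>i<m. \<mu> * v (Suc i))"
        using Suc_case unfolding sum_split[of "\<lambda>i. \<Sum>j<n. A $$ (i, j) * v j"] by simp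
      also have "\<dots> = \<mu> * v 0"
        by (simp add: v_Suc v_0 sum_distrib_left)
      finally have "(\<Sum>j<n. A $$ (i, j) * v j) = \<mu> * v i" if "i < n" for i
        using Suc_case that m by (cases i) auto
      moreover have "\<exists>i<n. v i \<noteq> 0"
        using w(1) m v_Suc by (metis Suc_mono)
      ultimately show "\<exists>v. ?ev' v"
        using sum0 by blast
    next
      assume "\<exists>v. ?ev' v"
      then obtain v where v: "?ev' v" by blast
      have "\<exists>i<m. v (Suc i) \<noteq> 0"
      proof (rule ccontr)
        assume "\<not> (\<exists>i<m. v (Suc i) \<noteq> 0)"
        then have *: "\<And>i. i < m \<Longrightarrow> v (Suc i) = 0" by blast
        then have "v 0 = 0" using v unfolding sum_split by simp
        then have "v i = 0" if "i < n" for i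
          using * that m by (cases i) auto
        then show False using v by blast
      qed
      moreover have "(\<Sum>i<m. B $$ (i, j) * v (Suc i)) = \<mu> * v (Suc j)" if "j < m" for j
        using key[of v j] that v m by auto
      ultimately show "\<exists>w. ?ev w"
        by (intro exI[of _ "\<lambda>i. v (Suc i)"]) blast
    qed
  qed
  finally show ?thesis .
qed

text \<open>Asking for sum zero, and not for a nonconstant function, matches the removal of exactly
  one copy of 1: a disconnected graph keeps the eigenvalue 1, with a combination of indicators of
  its components as eigenfunction.\<close>

lemma mem_spectrum_regular_graph_iff:
  assumes V: "finite V" "V \<noteq> {}" and D: "0 < D" and deg: "\<And>u. u \<in> V \<Longrightarrow> degree_in V E u = D"
  shows "\<mu> \<in># proots (char_poly (normalized_adjacency_mat V E)) - {#1#} \<longleftrightarrow>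
    (\<exists>f. (\<exists>u\<in>V. f u \<noteq> 0) \<and> sum f V = 0
      \<and> (\<forall>u\<in>V. (\<Sum>v | v \<in> V \<and> {u, v} \<in> E. f v) = real D * \<mu> * f u))"
proof -
  define n where "n = card V"
  define x where "x = from_nat_into V"
  define A where "A = normalized_adjacency_mat V E"
  have bij: "bij_betw x {..<n} V"
    unfolding x_def n_def by (rule bij_betw_from_nat_into_finite[OF V(1)])
  have x_V: "x i \<in> V" if "i < n" for i
    using bij_betwE[OF bij] that by auto
  have A: "A \<in> carrier_mat n n" and n: "0 < n"
    using V by (auto simp: A_def n_def normalized_adjacency_mat_def card_gt_0_iff)
  have entry: "A $$ (i, j) = of_bool ({x i, x j} \<in> E) / D" if "i < n" "j < n" for i j
    using that deg[OF x_V[of i]]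
    unfolding A_def normalized_adjacency_mat_def n_def[symmetric] x_def[symmetric] by simp
  have reindex: "(\<Sum>j<n. g (x j)) = sum g V" for g :: "'a \<Rightarrow> real"
    by (rule sum.reindex_bij_betw[OF bij])
  have row: "(\<Sum>j<n. A $$ (i, j) * g (x j)) = (\<Sum>v | v \<in> V \<and> {x i, v} \<in> E. g v) / D"
    if "i < n" for g :: "'a \<Rightarrow> real" and i
  proof -
    have "(\<Sum>j<n. A $$ (i, j) * g (x j)) = (\<Sum>j<n. of_bool ({x i, x j} \<in> E) * g (x j)) / D"
      unfolding sum_divide_distrib using that by (intro sum.cong) (simp_all add: entry)
    also have "\<dots> = (\<Sum>v\<in>V. of_bool ({x i, v} \<in> E) * g v) / D"
      using reindex[of "\<lambda>v. of_bool ({x i, v} \<in> E) * g v"] by simp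
    also have "(\<Sum>v\<in>V. of_bool ({x i, v} \<in> E) * g v) = (\<Sum>v | v \<in> V \<and> {x i, v} \<in> E. g v)"
      using V(1) by (intro sum.mono_neutral_cong_right) auto
    finally show ?thesis .
  qed
  have "\<mu> \<in># proots (char_poly A) - {#1#} \<longleftrightarrow>
    (\<exists>v. (\<exists>i<n. v i \<noteq> 0) \<and> (\<Sum>i<n. v i) = 0 \<and> (\<forall>i<n. (\<Sum>j<n. A $$ (i, j) * v j) = \<mu> * v i))"
    (is "_ \<longleftrightarrow> (\<exists>v. ?ev v)")
  proof (rule proots_minus_one_iff_eigenvector_orthogonal_ones[OF A n])
    show "A $$ (i, j) = A $$ (j, i)" if "i < n" "j < n" for i j
      using that by (simp add: entry insert_commute)
    show "(\<Sum>j<n. A $$ (i, j)) = 1" if "i < n" for i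
      using row[OF that, of "\<lambda>_. 1"] deg[OF x_V[OF that]] D by (simp add: degree_in_def)
  qed
  also have "\<dots> \<longleftrightarrow> (\<exists>f. ?ev (\<lambda>i. f (x i)))"
  proof
    assume "\<exists>v. ?ev v"
    then obtain v where v: "?ev v" by blast
    let ?f = "\<lambda>u. v (inv_into {..<n} x u)"
    have f_x: "?f (x i) = v i" if "i < n" for i
      using bij that by (simp add: bij_betw_def)
    obtain i where "i < n" "v i \<noteq> 0" using v by blast
    then have "\<exists>i<n. ?f (x i) \<noteq> 0"
      using f_x by (intro exI[of _ i]) simp
    moreover have "(\<Sum>i<n. ?f (x i)) = 0"
      using v f_x by simp
    moreover have "(\<Sum>j<n. A $$ (i, j) * ?f (x j)) = \<mu> * ?f (x i)" if "i < n" for i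
      using v f_x that by simp
    ultimately have "?ev (\<lambda>i. ?f (x i))" by blast
    then show "\<exists>f. ?ev (\<lambda>i. f (x i))" by (rule exI[of _ ?f])
  next
    assume "\<exists>f. ?ev (\<lambda>i. f (x i))"
    then obtain f where "?ev (\<lambda>i. f (x i))" ..
    then show "\<exists>v. ?ev v" by (rule exI[of _ "\<lambda>i. f (x i)"])
  qed
  also have "\<dots> \<longleftrightarrow> (\<exists>f. (\<exists>u\<in>V. f u \<noteq> 0) \<and> sum f V = 0
      \<and> (\<forall>u\<in>V. (\<Sum>v | v \<in> V \<and> {u, v} \<in> E. f v) = real D * \<mu> * f u))"
  proof (rule ex_cong1)
    fix f :: "'a \<Rightarrow> real"
    have V_eq: "V = x ` {..<n}"
      using bij by (simp add: bij_betw_def)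
    have "(\<exists>i<n. f (x i) \<noteq> 0) \<longleftrightarrow> (\<exists>u\<in>V. f u \<noteq> 0)"
      unfolding V_eq by auto
    moreover have "(\<forall>i<n. (\<Sum>j<n. A $$ (i, j) * f (x j)) = \<mu> * f (x i))
        \<longleftrightarrow> (\<forall>i\<in>{..<n}. (\<Sum>v | v \<in> V \<and> {x i, v} \<in> E. f v) = real D * \<mu> * f (x i))"
    proof -
      have "(\<Sum>j<n. A $$ (i, j) * f (x j)) = \<mu> * f (x i) \<longleftrightarrow>
          (\<Sum>v | v \<in> V \<and> {x i, v} \<in> E. f v) = real D * \<mu> * f (x i)" if "i < n" for i
        unfolding row[OF that] using D by (simp add: field_simps)
      then show ?thesis by (simp add: Ball_def)
    qed
    moreover have "\<dots> \<longleftrightarrow> (\<forall>u\<in>x ` {..<n}. (\<Sum>v | v \<in> V \<and> {u, v} \<in> E. f v) = real D * \<mu> * f u)"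
      by blast
    ultimately show "?ev (\<lambda>i. f (x i)) \<longleftrightarrow> (\<exists>u\<in>V. f u \<noteq> 0) \<and> sum f V = 0
      \<and> (\<forall>u\<in>V. (\<Sum>v | v \<in> V \<and> {u, v} \<in> E. f v) = real D * \<mu> * f u)"
      unfolding reindex[of f] V_eq[symmetric] by presburger
  qed
  finally show ?thesis unfolding A_def .
qed

lemma graph_lambda_nonneg: "0 \<le> graph_lambda V E"
  unfolding graph_lambda_def by (rule Max_ge) auto

lemma eigenvalue_le_graph_lambda:
  assumes "finite V" "0 < D" "\<And>u. u \<in> V \<Longrightarrow> degree_in V E u = D"
    and "\<exists>u\<in>V. f u \<noteq> 0" "sum f V = 0"
    and "\<And>u. u \<in> V \<Longrightarrow> (\<Sum>v | v \<in> V \<and> {u, v} \<in> E. f v) = real D * \<mu> * f u"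
  shows "\<bar>\<mu>\<bar> \<le> graph_lambda V E"
proof -
  have "\<mu> \<in># proots (char_poly (normalized_adjacency_mat V E)) - {#1#}"
  proof (subst mem_spectrum_regular_graph_iff[of V D])
    show "\<exists>f. (\<exists>u\<in>V. f u \<noteq> 0) \<and> sum f V = 0
      \<and> (\<forall>u\<in>V. (\<Sum>v | v \<in> V \<and> {u, v} \<in> E. f v) = real D * \<mu> * f u)"
      using assms(4-6) by (intro exI[of _ f]) simp
  qed (use assms(1-4) in auto)
  then show ?thesis
    unfolding graph_lambda_def by (intro Max_ge) auto
qed

lemma graph_lambda_le:
  assumes "finite V" "V \<noteq> {}" "0 < D" "\<And>u. u \<in> V \<Longrightarrow> degree_in V E u = D" "0 \<le> c"
    and "\<And>f \<mu>. \<exists>u\<in>V. f u \<noteq> 0 \<Longrightarrow> sum f V = 0 \<Longrightarrow>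
      (\<And>u. u \<in> V \<Longrightarrow> (\<Sum>v | v \<in> V \<and> {u, v} \<in> E. f v) = real D * \<mu> * f u) \<Longrightarrow> \<bar>\<mu>\<bar> \<le> c"
  shows "graph_lambda V E \<le> c"
proof -
  have "\<bar>\<mu>\<bar> \<le> c" if mem: "\<mu> \<in># proots (char_poly (normalized_adjacency_mat V E)) - {#1#}" for \<mu>
  proof -
    have "\<exists>f. (\<exists>u\<in>V. f u \<noteq> 0) \<and> sum f V = 0
      \<and> (\<forall>u\<in>V. (\<Sum>v | v \<in> V \<and> {u, v} \<in> E. f v) = real D * \<mu> * f u)"
      by (rule iffD1[OF mem_spectrum_regular_graph_iff mem]) (use assms(1-4) in simp_all)
    then obtain f where "\<exists>u\<in>V. f u \<noteq> 0" "sum f V = 0"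
      "\<forall>u\<in>V. (\<Sum>v | v \<in> V \<and> {u, v} \<in> E. f v) = real D * \<mu> * f u"
      by (elim exE conjE) (rule that)
    then show ?thesis by (intro assms(6)[of f \<mu>]) auto
  qed
  then show ?thesis
    unfolding graph_lambda_def using assms(5) by (intro Max.boundedI) auto
qed

lemma graph_lambda_empty: "graph_lambda {} E = 0"
proof -
  have "char_poly (normalized_adjacency_mat {} E) = 1"
    by (simp add: normalized_adjacency_mat_def char_poly_defs)
  then show ?thesis by (simp add: graph_lambda_def)
qed

section \<open>Norm bounds from eigenvalue bounds\<close>

lemma symmetric_kernel_maximizer:
  fixes A :: "('v \<Rightarrow> real) \<Rightarrow> 'v \<Rightarrow> real"
    and g :: "'v \<Rightarrow> real"
  assumes V: "finite V" and A: "\<And>f u. A f u = (\<Sum>v\<in>V. K u v * f v)"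
    and g: "sum g V = 0" "\<exists>u\<in>V. g u \<noteq> 0"
  obtains f where "sum f V = 0" "(\<Sum>u\<in>V. (f u)\<^sup>2) = 1"
    "\<And>h. sum h V = 0 \<Longrightarrow> (\<Sum>u\<in>V. (A h u)\<^sup>2) \<le> (\<Sum>u\<in>V. (A f u)\<^sup>2) * (\<Sum>u\<in>V. (h u)\<^sup>2)"
proof -
  \<comment> \<open>Functions live on the whole type, where the unit sphere of \<open>V\<close> need
    not be compact. Values zero outside \<open>V\<close> and in \<open>{- 1..1}\<close> on
    \<open>V\<close> place it inside a product of compact sets.\<close>
  define B where "B = PiE UNIV (\<lambda>v. if v \<in> V then {- 1..1} else {0 :: real})"
  define S where "S = {f \<in> B. sum f V = 0 \<and> (\<Sum>u\<in>V. (f u)\<^sup>2) = 1}"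
  have "compactin (product_topology (\<lambda>i. euclidean) UNIV) B"
    unfolding B_def compactin_PiE by auto
  then have "compact B"
    by (simp add: euclidean_product_topology)
  have coord: "continuous_on X (\<lambda>f :: 'v \<Rightarrow> real. f v)" for X and v :: 'v
    by (rule continuous_on_subset[OF continuous_on_product_coordinates]) simp
  have "closed {f. sum f V = (0::real)}" "closed {f. (\<Sum>u\<in>V. (f u)\<^sup>2) = (1::real)}"
    by (intro closed_Collect_eq continuous_intros coord)+
  then have "compact (B \<inter> ({f. sum f V = 0} \<inter> {f. (\<Sum>u\<in>V. (f u)\<^sup>2) = 1}))"
    using \<open>compact B\<close> by (intro compact_Int_closed closed_Int)
  also have "B \<inter> ({f. sum f V = 0} \<inter> {f. (\<Sum>u\<in>V. (f u)\<^sup>2) = 1}) = S"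
    unfolding S_def by auto
  finally have S: "compact S" .
  have normalize: "\<exists>c>0. c\<^sup>2 = (\<Sum>u\<in>V. (h u)\<^sup>2) \<and> (\<lambda>u. if u \<in> V then h u / c else 0) \<in> S"
    if h: "sum h V = 0" "\<exists>u\<in>V. h u \<noteq> 0" for h :: "'v \<Rightarrow> real"
  proof -
    let ?s = "\<Sum>u\<in>V. (h u)\<^sup>2"
    have pos: "0 < ?s"
    proof -
      from h(2) obtain u where "u \<in> V" "h u \<noteq> 0" by blast
      then show ?thesis by (intro sum_pos2[OF V]) auto
    qed
    have le: "\<bar>h u\<bar> \<le> sqrt ?s" if "u \<in> V" for u
      using member_le_sum[of u V "\<lambda>u. (h u)\<^sup>2"] that V by (intro real_le_rsqrt) simp
    have "h u / sqrt ?s \<in> {- 1..1}" if "u \<in> V" for u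
      using le[OF that] pos by (simp add: abs_le_iff field_simps)
    then have "(\<lambda>u. if u \<in> V then h u / sqrt ?s else 0) \<in> B"
      unfolding B_def by auto
    then have "(\<lambda>u. if u \<in> V then h u / sqrt ?s else 0) \<in> S"
      unfolding S_def using h(1) pos
      by (simp add: sum_divide_distrib[symmetric] power_divide)
    with pos show ?thesis
      by (intro exI[of _ "sqrt ?s"]) auto
  qed
  have "S \<noteq> {}"
    using normalize[OF g] by blast
  moreover have "continuous_on S (\<lambda>f. \<Sum>u\<in>V. (A f u)\<^sup>2)"
    unfolding A by (intro continuous_intros coord)
  ultimately obtain f where f: "f \<in> S" "\<And>h. h \<in> S \<Longrightarrow> (\<Sum>u\<in>V. (A h u)\<^sup>2) \<le> (\<Sum>u\<in>V. (A f u)\<^sup>2)"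
    using continuous_attains_sup[OF S] by blast
  show ?thesis
  proof (rule that)
    show "sum f V = 0" "(\<Sum>u\<in>V. (f u)\<^sup>2) = 1"
      using f(1) by (auto simp: S_def)
    fix h :: "'v \<Rightarrow> real" assume h: "sum h V = 0"
    show "(\<Sum>u\<in>V. (A h u)\<^sup>2) \<le> (\<Sum>u\<in>V. (A f u)\<^sup>2) * (\<Sum>u\<in>V. (h u)\<^sup>2)"
    proof (cases "\<exists>u\<in>V. h u \<noteq> 0")
      case True
      then obtain c where c: "c > 0" "c\<^sup>2 = (\<Sum>u\<in>V. (h u)\<^sup>2)" "(\<lambda>u. if u \<in> V then h u / c else 0) \<in> S"
        using normalize[OF h] by blast
      have "A (\<lambda>u. if u \<in> V then h u / c else 0) u = A h u / c" for u
        unfolding A sum_divide_distrib by (intro sum.cong) auto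
      then have "(\<Sum>u\<in>V. (A h u)\<^sup>2) / c\<^sup>2 \<le> (\<Sum>u\<in>V. (A f u)\<^sup>2)"
        using f(2)[OF c(3)] by (simp add: power_divide sum_divide_distrib)
      then show ?thesis
        using c(1) by (simp add: c(2)[symmetric] field_simps)
    next
      case False
      then show ?thesis by (simp add: A)
    qed
  qed
qed

text \<open>A maximizer f of |A f|^2 satisfies A^2 f = m f, that is (A - sqrt m)(A + sqrt m) f = 0.
  Hence either A f = - sqrt m f, or A f + sqrt m f is an eigenvector for sqrt m, and
  \<open>ev\<close> bounds sqrt m by \<open>c\<close> in both cases. The constant row sums keep A
  inside the functions with sum zero.\<close>

lemma symmetric_kernel_norm_le:
  fixes K :: "'v \<Rightarrow> 'v \<Rightarrow> real"
  assumes V: "finite V" and sym: "\<And>u v. u \<in> V \<Longrightarrow> v \<in> V \<Longrightarrow> K u v = K v u"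
    and row: "\<And>u. u \<in> V \<Longrightarrow> (\<Sum>v\<in>V. K u v) = \<kappa>"
    and ev: "\<And>\<mu> f. \<exists>u\<in>V. f u \<noteq> 0 \<Longrightarrow> sum f V = 0 \<Longrightarrow>
      (\<And>u. u \<in> V \<Longrightarrow> (\<Sum>v\<in>V. K u v * f v) = \<mu> * f u) \<Longrightarrow> \<bar>\<mu>\<bar> \<le> c"
    and g: "sum g V = 0"
  shows "(\<Sum>u\<in>V. (\<Sum>v\<in>V. K u v * g v)\<^sup>2) \<le> c\<^sup>2 * (\<Sum>u\<in>V. (g u)\<^sup>2)"
proof (cases "\<exists>u\<in>V. g u \<noteq> 0")
  case False
  then show ?thesis by simp
next
  case True
  define A where "A f u = (\<Sum>v\<in>V. K u v * f v)" for f u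
  obtain f where f: "sum f V = 0" "(\<Sum>u\<in>V. (f u)\<^sup>2) = 1"
    "\<And>h. sum h V = 0 \<Longrightarrow> (\<Sum>u\<in>V. (A h u)\<^sup>2) \<le> (\<Sum>u\<in>V. (A f u)\<^sup>2) * (\<Sum>u\<in>V. (h u)\<^sup>2)"
    by (rule symmetric_kernel_maximizer[of V A K, OF V A_def g True]) blast
  define m where "m = (\<Sum>u\<in>V. (A f u)\<^sup>2)"
  have m: "0 \<le> m"
    unfolding m_def by (rule sum_nonneg) simp
  have selfadj: "(\<Sum>u\<in>V. A f u * h u) = (\<Sum>u\<in>V. f u * A h u)" for f h
  proof -
    have "(\<Sum>u\<in>V. A f u * h u) = (\<Sum>u\<in>V. \<Sum>v\<in>V. K u v * f v * h u)"
      unfolding A_def sum_distrib_right by simp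
    also have "\<dots> = (\<Sum>v\<in>V. \<Sum>u\<in>V. K u v * f v * h u)"
      by (rule sum.swap)
    also have "\<dots> = (\<Sum>v\<in>V. \<Sum>u\<in>V. f v * (K v u * h u))"
      using sym by (intro sum.cong) auto
    finally show ?thesis
      unfolding A_def sum_distrib_left .
  qed
  have sum_A: "sum (A h) V = \<kappa> * sum h V" for h
  proof -
    have "A (\<lambda>_. 1) u = \<kappa>" if "u \<in> V" for u
      using row[OF that] by (simp add: A_def)
    then show ?thesis
      using selfadj[of h "\<lambda>_. 1"] by (simp add: sum_distrib_right[symmetric])
  qed
  have A_lin: "A (\<lambda>u. a * h u + b * k u) u = a * A h u + b * A k u" for a b h k u
    unfolding A_def by (simp add: algebra_simps sum.distrib sum_distrib_left)
  text \<open>A maximizer is a critical point: the form \<open>m |h|\<^sup>2 - |A h|\<^sup>2\<close> is nonnegative and vanishes at \<open>f\<close>.\<close>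
  have crit: "m * (\<Sum>u\<in>V. f u * h u) = (\<Sum>u\<in>V. A f u * A h u)" if h: "sum h V = 0" for h
  proof -
    define \<beta> where "\<beta> = m * (\<Sum>u\<in>V. f u * h u) - (\<Sum>u\<in>V. A f u * A h u)"
    define \<gamma> where "\<gamma> = m * (\<Sum>u\<in>V. (h u)\<^sup>2) - (\<Sum>u\<in>V. (A h u)\<^sup>2)"
    have nonneg: "0 \<le> 2 * t * \<beta> + t\<^sup>2 * \<gamma>" for t
    proof -
      have sq: "(\<Sum>u\<in>V. (1 * p u + t * q u)\<^sup>2)
          = (\<Sum>u\<in>V. (p u)\<^sup>2) + 2 * t * (\<Sum>u\<in>V. p u * q u) + t\<^sup>2 * (\<Sum>u\<in>V. (q u)\<^sup>2)" for p q :: "'v \<Rightarrow> real"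
        by (simp add: power2_eq_square algebra_simps sum.distrib sum_distrib_left)
      have "sum (\<lambda>u. 1 * f u + t * h u) V = 0"
        using f(1) h by (simp add: sum.distrib sum_distrib_left[symmetric])
      from f(3)[OF this] show ?thesis
        unfolding A_lin sq f(2) m_def[symmetric] \<beta>_def \<gamma>_def by (simp add: algebra_simps)
    qed
    have "\<beta> = 0"
    proof (rule ccontr)
      assume "\<beta> \<noteq> 0"
      \<comment> \<open>At t = - \<beta> / N the form equals (\<beta> / N)^2 (\<gamma> - 2 N); this
        choice of N makes it negative whatever the sign of \<gamma>.\<close>
      define N where "N = \<bar>\<gamma>\<bar> + 1"
      have N: "0 < N" "\<gamma> < 2 * N"
        by (auto simp: N_def)
      have "0 \<le> 2 * (- \<beta> / N) * \<beta> + (- \<beta> / N)\<^sup>2 * \<gamma>"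
        by (rule nonneg)
      also have "\<dots> = (\<beta> / N)\<^sup>2 * (\<gamma> - 2 * N)"
        using N(1) by (simp add: field_simps power2_eq_square)
      also have "\<dots> < 0"
        using \<open>\<beta> \<noteq> 0\<close> N by (intro mult_pos_neg) auto
      finally show False by simp
    qed
    then show ?thesis by (simp add: \<beta>_def)
  qed
  \<comment> \<open>Testing criticality against the residual m f - A^2 f itself makes the norm of
    the residual vanish.\<close>
  define w where "w u = m * f u + (- 1) * A (A f) u" for u
  have "sum w V = 0"
    unfolding w_def by (simp add: sum.distrib sum_subtractf sum_distrib_left[symmetric] sum_A f(1))
  from crit[OF this] have "m * (\<Sum>u\<in>V. f u * w u) = (\<Sum>u\<in>V. A (A f) u * w u)"
    unfolding selfadj[of "A f" w] .
  then have "(\<Sum>u\<in>V. (m * f u - A (A f) u) * w u) = 0"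
    by (simp add: left_diff_distrib sum_subtractf sum_distrib_left mult.assoc)
  then have "(\<Sum>u\<in>V. (w u)\<^sup>2) = 0"
    by (simp add: w_def power2_eq_square)
  then have AA: "A (A f) u = m * f u" if "u \<in> V" for u
    using that V by (auto simp: sum_nonneg_eq_0_iff w_def)
  have sqrt_le: "sqrt m \<le> c"
  proof (cases "\<exists>u\<in>V. A f u + sqrt m * f u \<noteq> 0")
    case False
    have "\<exists>u\<in>V. f u \<noteq> 0"
    proof (rule ccontr)
      assume "\<not> (\<exists>u\<in>V. f u \<noteq> 0)"
      then have "(\<Sum>u\<in>V. (f u)\<^sup>2) = 0" by simp
      then show False using f(2) by simp
    qed
    moreover have "(\<Sum>v\<in>V. K u v * f v) = - sqrt m * f u" if "u \<in> V" for u
      using False that by (auto simp: A_def[symmetric] eq_neg_iff_add_eq_0)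
    ultimately have "\<bar>- sqrt m\<bar> \<le> c"
      by (rule ev[OF _ f(1)])
    then show ?thesis using m by simp
  next
    case True
    let ?w = "\<lambda>u. 1 * A f u + sqrt m * f u"
    have "\<bar>sqrt m\<bar> \<le> c"
    proof (rule ev[of ?w])
      show "sum ?w V = 0"
        by (simp add: sum.distrib sum_A f(1) sum_distrib_left[symmetric])
      show "(\<Sum>v\<in>V. K u v * ?w v) = sqrt m * ?w u" if "u \<in> V" for u
        unfolding A_def[symmetric] A_lin using AA[OF that] m by (simp add: algebra_simps)
    qed (use True in simp)
    then show ?thesis using m by simp
  qed
  then have "m \<le> c\<^sup>2"
    using power_mono[OF sqrt_le, of 2] m by simp
  have "(\<Sum>u\<in>V. (A g u)\<^sup>2) \<le> m * (\<Sum>u\<in>V. (g u)\<^sup>2)"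
    using f(3)[OF g] by (simp add: m_def)
  also have "\<dots> \<le> c\<^sup>2 * (\<Sum>u\<in>V. (g u)\<^sup>2)"
    using \<open>m \<le> c\<^sup>2\<close> by (intro mult_right_mono sum_nonneg) auto
  finally show ?thesis unfolding A_def .
qed

section \<open>The zig-zag estimate\<close>

text \<open>The zig-zag function is the larger root of t^2 - (1 - y^2) x t - y^2; it enters the main
  estimate through this equation.\<close>

lemma zigzag_fun_root: "(zigzag_fun x y)\<^sup>2 = (1 - y\<^sup>2) * x * zigzag_fun x y + y\<^sup>2"
proof -
  define c where "c = (1 - y\<^sup>2) * x"
  define s where "s = sqrt (c\<^sup>2 + 4 * y\<^sup>2)"
  have s: "s\<^sup>2 = c\<^sup>2 + 4 * y\<^sup>2"
    unfolding s_def by simp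
  have z: "zigzag_fun x y = c / 2 + s / 2"
    unfolding zigzag_fun_def c_def s_def by (simp add: power_mult_distrib)
  show ?thesis
    unfolding c_def[symmetric] z using s by (simp add: power2_eq_square field_simps)
qed

lemma zigzag_fun_ge:
  assumes "0 \<le> x" "0 \<le> y" "y \<le> 1"
  shows "y \<le> zigzag_fun x y"
proof -
  have "2 * y \<le> sqrt ((1 - y\<^sup>2)\<^sup>2 * x\<^sup>2 + 4 * y\<^sup>2)"
    by (intro real_le_rsqrt) (simp add: power_mult_distrib)
  moreover have "0 \<le> (1 - y\<^sup>2) * x"
    using assms by (simp add: power_le_one)
  ultimately show ?thesis
    using assms unfolding zigzag_fun_def by simp
qed

text \<open>For x = 1 the quadratic factors as (t - 1)(t + y^2), and for larger x the equation still
  gives (f - 1)(f + y^2) \<ge> 0. The second factor vanishes only for f = y = 0, which the explicit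
  formula rules out.\<close>

lemma zigzag_fun_ge_1:
  assumes "1 \<le> x" "0 \<le> y" "y \<le> 1"
  shows "1 \<le> zigzag_fun x y"
proof (rule ccontr)
  define f where "f = zigzag_fun x y"
  assume "\<not> 1 \<le> zigzag_fun x y"
  then have f: "f < 1" "0 \<le> f"
    using zigzag_fun_ge[of x y] assms by (auto simp: f_def)
  have y: "0 \<le> 1 - y\<^sup>2"
    using assms by (simp add: power_le_one)
  have root: "f\<^sup>2 = (1 - y\<^sup>2) * x * f + y\<^sup>2"
    unfolding f_def by (rule zigzag_fun_root)
  moreover have "(1 - y\<^sup>2) * f * 1 \<le> (1 - y\<^sup>2) * f * x"
    using y f assms by (intro mult_left_mono mult_nonneg_nonneg) auto
  ultimately have "0 \<le> (f - 1) * (f + y\<^sup>2)"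
    by (simp add: power2_eq_square algebra_simps)
  then have "f + y\<^sup>2 \<le> 0"
    using f by (simp add: zero_le_mult_iff)
  then have "f = 0" and "y\<^sup>2 = 0"
    using f zero_le_power2[of y] by linarith+
  then have "y = 0" by simp
  with \<open>f = 0\<close> show False
    using assms unfolding f_def zigzag_fun_def by simp
qed

lemma zigzag_fun_le_1:
  assumes "x \<le> 1" "0 \<le> x" "0 \<le> y" "y \<le> 1"
  shows "zigzag_fun x y \<le> 1"
proof (rule ccontr)
  define f where "f = zigzag_fun x y"
  assume "\<not> zigzag_fun x y \<le> 1"
  then have f: "1 < f"
    by (auto simp: f_def)
  have y: "0 \<le> 1 - y\<^sup>2"
    using assms by (simp add: power_le_one)
  have root: "f\<^sup>2 = (1 - y\<^sup>2) * x * f + y\<^sup>2"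
    unfolding f_def by (rule zigzag_fun_root)
  moreover have "(1 - y\<^sup>2) * f * x \<le> (1 - y\<^sup>2) * f * 1"
    using y f assms by (intro mult_left_mono mult_nonneg_nonneg) auto
  ultimately have "(f - 1) * (f + y\<^sup>2) \<le> 0"
    by (simp add: power2_eq_square algebra_simps)
  moreover have "0 < (f - 1) * (f + y\<^sup>2)"
    using f by (intro mult_pos_pos add_pos_nonneg) auto
  ultimately show False by simp
qed

text \<open>The vectors (- b, a) and (c, - b) give a and c times the determinant a c - b^2. If a and
  c both vanish, (1, 1) and (1, - 1) force b = 0.\<close>

lemma nonneg_form_discriminant:
  fixes a b c :: real
  assumes "\<And>s t. 0 \<le> s\<^sup>2 * a + 2 * s * t * b + t\<^sup>2 * c"
  shows "b\<^sup>2 \<le> a * c"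
proof -
  have a: "0 \<le> a" using assms[of 1 0] by simp
  have c: "0 \<le> c" using assms[of 0 1] by simp
  have A: "0 \<le> a * (a * c - b\<^sup>2)"
    using assms[of "- b" a] by (simp add: power2_eq_square algebra_simps)
  have C: "0 \<le> c * (a * c - b\<^sup>2)"
    using assms[of c "- b"] by (simp add: power2_eq_square algebra_simps)
  show ?thesis
  proof (cases "a = 0 \<and> c = 0")
    case True
    then have "b = 0" using assms[of 1 1] assms[of 1 "- 1"] by simp
    then show ?thesis using True by simp
  next
    case False
    then show ?thesis using a c A C by (auto simp: zero_le_mult_iff)
  qed
qed

text \<open>The numerical core of the Reingold--Vadhan--Wigderson bound: \<open>p\<close>, \<open>q\<close>, \<open>r\<close> are the entries of
  the form of a reflection on two orthogonal vectors of squared lengths \<open>a\<close> and \<open>b\<close>.\<close>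

lemma reflection_form_le_zigzag_fun:
  fixes a b p q r x y :: real
  assumes form: "\<And>s t. \<bar>s\<^sup>2 * p + 2 * s * t * q + t\<^sup>2 * r\<bar> \<le> s\<^sup>2 * a + t\<^sup>2 * b"
    and p: "p \<le> x * a" and x: "0 \<le> x" and y: "0 < y" "y \<le> 1"
  shows "p + 2 * q + r \<le> zigzag_fun x y * (a + b / y\<^sup>2)"
proof -
  define f where "f = zigzag_fun x y"
  have root: "f\<^sup>2 = (1 - y\<^sup>2) * x * f + y\<^sup>2"
    unfolding f_def by (rule zigzag_fun_root)
  have fy: "y \<le> f"
    unfolding f_def using x y by (intro zigzag_fun_ge) auto
  have y2: "0 < y\<^sup>2" "y\<^sup>2 \<le> y" "y\<^sup>2 \<le> 1"
    using y by (auto simp: power2_eq_square mult_left_le mult_le_one)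
  have a: "0 \<le> a" "\<bar>p\<bar> \<le> a"
    using form[of 1 0] by auto
  have b: "0 \<le> b" "\<bar>r\<bar> \<le> b"
    using form[of 0 1] by auto
  have fb: "b \<le> f * b / y\<^sup>2"
  proof -
    have "b * y\<^sup>2 \<le> b * f"
      using b fy y2 by (intro mult_left_mono) auto
    then show ?thesis using y2 by (simp add: field_simps)
  qed
  have ab: "p + 2 * q + r \<le> a + b"
    using form[of 1 1] by auto
  \<comment> \<open>Compressed to the two vectors, 1 - R and 1 + R are both nonnegative;
    \<open>disc1\<close> and \<open>disc2\<close> say that their determinants are.\<close>
  have disc1: "q\<^sup>2 \<le> (a - p) * (b - r)"
  proof -
    have "(- q)\<^sup>2 \<le> (a - p) * (b - r)"
    proof (rule nonneg_form_discriminant)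
      show "0 \<le> s\<^sup>2 * (a - p) + 2 * s * t * (- q) + t\<^sup>2 * (b - r)" for s t
        using form[of s t] by (simp add: algebra_simps abs_le_iff)
    qed
    then show ?thesis by simp
  qed
  have disc2: "q\<^sup>2 \<le> (a + p) * (b + r)"
  proof (rule nonneg_form_discriminant)
    show "0 \<le> s\<^sup>2 * (a + p) + 2 * s * t * q + t\<^sup>2 * (b + r)" for s t
      using form[of s t] by (simp add: algebra_simps abs_le_iff)
  qed
  \<comment> \<open>For x \<ge> 1 the trivial bound a + b suffices because f \<ge> 1. For a = 0 the
    discriminants force q = 0. Otherwise p < a, which permits the final division by a - p.\<close>
  consider "1 \<le> x" | "a = 0" | "x < 1" "0 < a"
    using a by linarith
  then have "p + 2 * q + r \<le> f * (a + b / y\<^sup>2)"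
  proof cases
    case 1
    then have "1 \<le> f"
      unfolding f_def using y by (intro zigzag_fun_ge_1) auto
    then have "1 * a \<le> f * a"
      using a by (intro mult_right_mono) auto
    then show ?thesis
      using ab fb by (simp add: algebra_simps)
  next
    case 2
    then have "p = 0" "q = 0"
      using a disc1 disc2 by auto
    then show ?thesis
      using 2 b fb by (simp add: abs_le_iff)
  next
    case 3
    have f1: "f \<le> 1"
      unfolding f_def using x y 3 by (intro zigzag_fun_le_1) auto
    have xa: "x * a < a"
      using 3 by simp
    have "p < a"
      using p xa by simp
    have "x * f < 1"
      using 3 mult_left_mono[OF f1 x] by simp
    then have "0 < y\<^sup>2 * (1 - x * f)"
      using y2 by simp
    also have "\<dots> = f * (f - x)"
      using root by (simp add: power2_eq_square algebra_simps)
    finally have "x < f"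
      using fy y by (simp add: zero_less_mult_iff)
    then have "x * a \<le> f * a"
      using 3 by simp
    with p have fp: "0 \<le> f * a - p"
      by simp
    have fr: "0 \<le> f * b / y\<^sup>2 - r"
      using fb b by (simp add: abs_le_iff)
    \<comment> \<open>\<open>disc1\<close> times a + p plus \<open>disc2\<close> times a - p: the
      unknown r cancels. For unit vectors this is Bessel's inequality for the image of the first one
      under R.\<close>
    have bessel: "q\<^sup>2 * a \<le> b * ((a - p) * (a + p))"
    proof -
      have "q\<^sup>2 * (a + p) \<le> (a - p) * (b - r) * (a + p)"
        using disc1 a by (intro mult_right_mono) auto
      moreover have "q\<^sup>2 * (a - p) \<le> (a + p) * (b + r) * (a - p)"
        using disc2 a by (intro mult_right_mono) auto
      ultimately show ?thesis
        by (simp add: algebra_simps)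
    qed
    \<comment> \<open>Expanded, this reads (1 - y^2) f p \<le> (f^2 - y^2) a. The quadratic equation
      turns the right-hand side into (1 - y^2) f x a, so the claim reduces to p \<le> x a. This is
      the point that dictates the zig-zag function.\<close>
    have key: "y\<^sup>2 * (1 - f) * (a + p) \<le> (f * a - p) * (f - y\<^sup>2)"
    proof -
      have "(1 - y\<^sup>2) * f * p \<le> (1 - y\<^sup>2) * f * (x * a)"
        using p y2 fy y by (intro mult_left_mono) auto
      also have "\<dots> = (f\<^sup>2 - y\<^sup>2) * a"
        unfolding root by (simp add: algebra_simps)
      finally show ?thesis
        by (simp add: power2_eq_square algebra_simps)
    qed
    have "q\<^sup>2 \<le> (f * a - p) * (f * b / y\<^sup>2 - r)"
    proof -
      have "(1 - f) * (q\<^sup>2 * a) * y\<^sup>2 \<le> (1 - f) * (b * ((a - p) * (a + p))) * y\<^sup>2"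
        using bessel f1 by (intro mult_right_mono mult_left_mono) auto
      also have "\<dots> = (b * (a - p)) * (y\<^sup>2 * (1 - f) * (a + p))"
        by (simp add: algebra_simps)
      also have "\<dots> \<le> (b * (a - p)) * ((f * a - p) * (f - y\<^sup>2))"
        using key b \<open>p < a\<close> by (intro mult_left_mono) auto
      finally have "(1 - f) * (q\<^sup>2 * a) \<le> (b * (a - p)) * ((f * a - p) * (f - y\<^sup>2)) / y\<^sup>2"
        using y2 by (simp add: field_simps)
      also have "\<dots> = (f * a - p) * ((a - p) * (f * b / y\<^sup>2 - b))"
        using y2 by (simp add: field_simps)
      finally have 1: "(1 - f) * (q\<^sup>2 * a) \<le> (f * a - p) * ((a - p) * (f * b / y\<^sup>2 - b))" .
      have 2: "(f * a - p) * q\<^sup>2 \<le> (f * a - p) * ((a - p) * (b - r))"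
        using disc1 fp by (intro mult_left_mono) auto
      \<comment> \<open>a - p is split as (1 - f) a + (f a - p): the first share of q^2 is bounded
        through \<open>bessel\<close> and \<open>key\<close>, the second through
        \<open>disc1\<close>.\<close>
      have "(a - p) * q\<^sup>2 = (1 - f) * (q\<^sup>2 * a) + (f * a - p) * q\<^sup>2"
        by (simp add: algebra_simps)
      also have "\<dots> \<le> (f * a - p) * ((a - p) * (f * b / y\<^sup>2 - b)) + (f * a - p) * ((a - p) * (b - r))"
        using 1 2 by simp
      also have "\<dots> = (a - p) * ((f * a - p) * (f * b / y\<^sup>2 - r))"
        by (simp add: algebra_simps)
      finally show ?thesis
        using \<open>p < a\<close> by simp
    qed
    moreover have "(2 * q)\<^sup>2 \<le> (\<alpha> + \<beta>)\<^sup>2" if "q\<^sup>2 \<le> \<alpha> * \<beta>" for \<alpha> \<beta>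
      using that zero_le_power2[of "\<alpha> - \<beta>"] by (simp add: power2_eq_square algebra_simps)
    ultimately have "(2 * q)\<^sup>2 \<le> ((f * a - p) + (f * b / y\<^sup>2 - r))\<^sup>2"
      by blast
    then have "2 * q \<le> (f * a - p) + (f * b / y\<^sup>2 - r)"
      using fp fr by (intro power2_le_imp_le[of "2 * q"]) auto
    then show ?thesis
      by (simp add: algebra_simps)
  qed
  then show ?thesis by (simp add: f_def)
qed

text \<open>\<open>F\<close> is an eigenvector of \<open>P M P\<close> with \<open>M = 1 \<otimes> N\<close> and \<open>P = (1 + R) / 2\<close> the projection on the
  functions invariant under the reflection \<open>R F = F \<circ> \<rho>\<close>, so that \<open>\<nu>\<^sup>2 |F|\<^sup>2 = (|M F|\<^sup>2 + \<langle>M F, R M F\<rangle>) / 2\<close>.\<close>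

lemma half_reflected_walk_eigenvalue_le:
  fixes G :: "'g set" and K :: "'k set" and N :: "'k \<Rightarrow> 'k \<Rightarrow> real" and F :: "'g \<times> 'k \<Rightarrow> real"
  assumes fin: "finite G" "finite K" "K \<noteq> {}"
    and row: "\<And>k. k \<in> K \<Longrightarrow> (\<Sum>k'\<in>K. N k k') = 1"
    and col: "\<And>k'. k' \<in> K \<Longrightarrow> (\<Sum>k\<in>K. N k k') = 1"
    and contr: "\<And>f. sum f K = 0 \<Longrightarrow> (\<Sum>k\<in>K. (\<Sum>k'\<in>K. N k k' * f k')\<^sup>2) \<le> y\<^sup>2 * (\<Sum>k\<in>K. (f k)\<^sup>2)"
    and \<rho>: "\<And>z. z \<in> G \<times> K \<Longrightarrow> \<rho> z \<in> G \<times> K" "\<And>z. z \<in> G \<times> K \<Longrightarrow> \<rho> (\<rho> z) = z"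
    and base: "\<And>\<phi>. sum \<phi> G = 0 \<Longrightarrow>
      (\<Sum>z\<in>G \<times> K. \<phi> (fst z) * \<phi> (fst (\<rho> z))) \<le> x * (real (card K) * (\<Sum>g\<in>G. (\<phi> g)\<^sup>2))"
    and xy: "0 \<le> x" "0 < y" "y \<le> 1"
    and F: "sum F (G \<times> K) = 0" "\<exists>z\<in>G \<times> K. F z \<noteq> 0"
    and ev: "\<And>g k. g \<in> G \<Longrightarrow> k \<in> K \<Longrightarrow>
      2 * \<nu> * F (g, k) = (\<Sum>k'\<in>K. N k k' * F (g, k'))
        + (\<Sum>k'\<in>K. N (snd (\<rho> (g, k))) k' * F (fst (\<rho> (g, k)), k'))"
  shows "\<bar>\<nu>\<bar> \<le> sqrt (1 / 2 + 1 / 2 * zigzag_fun x y)"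
proof -
  define X where "X = G \<times> K"
  define f where "f = zigzag_fun x y"
  define ip where "ip h h' = (\<Sum>z\<in>X. h z * h' z)" for h h' :: "'g \<times> 'k \<Rightarrow> real"
  \<comment> \<open>F is the sum of its cloud averages \<open>u\<close> and a part \<open>e\<close>
    with mean zero in every cloud. The walk inside the clouds fixes \<open>u\<close> and sends
    \<open>e\<close> to \<open>v\<close>, with |v| \<le> y |e|. Hence a + b / y^2 \<le> |F|^2, the
    reason for the weight 1 / y^2 in the numerical estimate.\<close>
  define \<phi> where "\<phi> g = (\<Sum>k\<in>K. F (g, k)) / card K" for g
  define u where "u z = \<phi> (fst z)" for z :: "'g \<times> 'k"
  define e where "e z = F z - u z" for z
  define v where "v z = (\<Sum>k'\<in>K. N (snd z) k' * e (fst z, k'))" for z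
  define w where "w z = u z + v z" for z
  have cK: "0 < real (card K)"
    using fin by (simp add: card_gt_0_iff)
  have sumX: "(\<Sum>z\<in>X. h z) = (\<Sum>g\<in>G. \<Sum>k\<in>K. h (g, k))" for h :: "'g \<times> 'k \<Rightarrow> real"
    unfolding X_def by (simp add: sum.cartesian_product)
  have e0: "(\<Sum>k\<in>K. e (g, k)) = 0" for g
    using cK by (simp add: e_def u_def sum_subtractf \<phi>_def)
  have wM: "w (g, k) = (\<Sum>k'\<in>K. N k k' * F (g, k'))" if "k \<in> K" for g k
    using row[OF that]
    by (simp add: w_def v_def e_def u_def right_diff_distrib sum_subtractf sum_distrib_right[symmetric])
  have swap: "(\<Sum>z\<in>X. h (\<rho> z)) = (\<Sum>z\<in>X. h z)" for h :: "'g \<times> 'k \<Rightarrow> real"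
  proof (rule sum.reindex_bij_betw)
    show "bij_betw \<rho> X X"
      using \<rho> unfolding X_def[symmetric] by (intro bij_betw_byWitness[where f' = \<rho>]) blast+
  qed
  have ip_R: "\<bar>ip h (\<lambda>z. h (\<rho> z))\<bar> \<le> ip h h" for h
  proof -
    have "\<bar>ip h (\<lambda>z. h (\<rho> z))\<bar> \<le> (\<Sum>z\<in>X. \<bar>h z * h (\<rho> z)\<bar>)"
      unfolding ip_def by (rule sum_abs)
    also have "\<dots> \<le> (\<Sum>z\<in>X. (h z * h z + h (\<rho> z) * h (\<rho> z)) / 2)"
    proof (rule sum_mono)
      fix z
      have "0 \<le> (\<bar>h z\<bar> - \<bar>h (\<rho> z)\<bar>)\<^sup>2" by simp
      then show "\<bar>h z * h (\<rho> z)\<bar> \<le> (h z * h z + h (\<rho> z) * h (\<rho> z)) / 2"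
        by (simp add: power2_eq_square algebra_simps abs_mult)
    qed
    also have "\<dots> = (ip h h + (\<Sum>z\<in>X. h (\<rho> z) * h (\<rho> z))) / 2"
      by (simp add: ip_def sum.distrib sum_divide_distrib[symmetric])
    also have "\<dots> = ip h h"
      using swap[of "\<lambda>z. h z * h z"] by (simp add: ip_def)
    finally show ?thesis .
  qed
  have const_orth: "ip u h = 0" if "\<And>g. (\<Sum>k\<in>K. h (g, k)) = 0" for h
    unfolding ip_def sumX by (simp add: u_def sum_distrib_left[symmetric] that)
  have v0: "(\<Sum>k\<in>K. v (g, k)) = 0" for g
  proof -
    have "(\<Sum>k\<in>K. v (g, k)) = (\<Sum>k'\<in>K. (\<Sum>k\<in>K. N k k') * e (g, k'))"
      unfolding v_def sum_distrib_right fst_conv snd_conv by (rule sum.swap)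
    then show ?thesis using col e0 by simp
  qed
  have uv: "ip u v = 0" and ue: "ip u e = 0"
    by (intro const_orth v0 e0)+
  have ip_bilin: "ip (\<lambda>z. s * h z + t * h' z) (\<lambda>z. s * k z + t * k' z)
      = s\<^sup>2 * ip h k + s * t * (ip h k' + ip h' k) + t\<^sup>2 * ip h' k'" for s t h h' k k'
    by (simp add: ip_def sum.distrib sum_distrib_left power2_eq_square algebra_simps)
  have ip_comm: "ip h k = ip k h" for h k
    by (simp add: ip_def mult.commute)
  define a where "a = ip u u"
  define b where "b = ip v v"
  define p where "p = ip u (\<lambda>z. u (\<rho> z))"
  define q where "q = ip u (\<lambda>z. v (\<rho> z))"
  define r where "r = ip v (\<lambda>z. v (\<rho> z))"
  have q': "ip v (\<lambda>z. u (\<rho> z)) = q"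
  proof -
    have "ip v (\<lambda>z. u (\<rho> z)) = (\<Sum>z\<in>X. v (\<rho> z) * u (\<rho> (\<rho> z)))"
      unfolding ip_def using swap[of "\<lambda>z. v z * u (\<rho> z)"] by simp
    also have "\<dots> = q"
      unfolding q_def ip_def X_def using \<rho>(2) by (intro sum.cong) (auto simp: mult.commute)
    finally show ?thesis .
  qed
  have norm_F: "ip F F = a + ip e e"
  proof -
    have "F = (\<lambda>z. 1 * u z + 1 * e z)"
      by (simp add: e_def)
    then have "ip F F = ip (\<lambda>z. 1 * u z + 1 * e z) (\<lambda>z. 1 * u z + 1 * e z)"
      by (intro arg_cong2[where f = ip])
    then show ?thesis
      unfolding ip_bilin using ue ip_comm[of e u] by (simp add: a_def)
  qed
  have b_le: "b \<le> y\<^sup>2 * ip e e"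
  proof -
    have "b = (\<Sum>g\<in>G. \<Sum>k\<in>K. (\<Sum>k'\<in>K. N k k' * e (g, k'))\<^sup>2)"
      unfolding b_def ip_def sumX by (simp add: v_def power2_eq_square)
    also have "\<dots> \<le> (\<Sum>g\<in>G. y\<^sup>2 * (\<Sum>k\<in>K. (e (g, k))\<^sup>2))"
      by (intro sum_mono contr e0)
    finally show ?thesis
      by (simp add: ip_def sumX power2_eq_square sum_distrib_left)
  qed
  have form: "\<bar>s\<^sup>2 * p + 2 * s * t * q + t\<^sup>2 * r\<bar> \<le> s\<^sup>2 * a + t\<^sup>2 * b" for s t
    using ip_R[of "\<lambda>z. s * u z + t * v z"] uv ip_comm[of v u] q'
    unfolding ip_bilin a_def[symmetric] b_def[symmetric] p_def[symmetric] q_def[symmetric] r_def[symmetric]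
    by (simp add: algebra_simps)
  have "sum \<phi> G = 0"
    using F(1) unfolding X_def[symmetric] sumX by (simp add: \<phi>_def sum_divide_distrib[symmetric])
  from base[OF this] have "p \<le> x * (real (card K) * (\<Sum>g\<in>G. (\<phi> g)\<^sup>2))"
    unfolding p_def ip_def u_def X_def .
  also have "real (card K) * (\<Sum>g\<in>G. (\<phi> g)\<^sup>2) = a"
    unfolding a_def ip_def sumX by (simp add: u_def power2_eq_square sum_distrib_left)
  finally have p: "p \<le> x * a" .
  have f: "0 \<le> f"
    unfolding f_def using zigzag_fun_ge[of x y] xy by simp
  have y2: "0 < y\<^sup>2" "y\<^sup>2 \<le> 1"
    using xy by (auto simp: power_le_one)
  have ww: "ip w w = a + b" "ip w (\<lambda>z. w (\<rho> z)) = p + 2 * q + r"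
  proof -
    have w: "w = (\<lambda>z. u z + v z)"
      by (simp add: w_def fun_eq_iff)
    show "ip w w = a + b" "ip w (\<lambda>z. w (\<rho> z)) = p + 2 * q + r"
      using ip_bilin[of 1 u 1 v u v] ip_bilin[of 1 u 1 v "\<lambda>z. u (\<rho> z)" "\<lambda>z. v (\<rho> z)"]
        uv ip_comm[of v u] q'
      by (simp_all add: w a_def b_def p_def q_def r_def)
  qed
  \<comment> \<open>The eigenvalue equation says 2 \<nu> F = w + R w with w = M F; since R preserves
    the inner product, the norm expands to 2 |w|^2 + 2 <w, R w>.\<close>
  have "4 * \<nu>\<^sup>2 * ip F F = ip (\<lambda>z. 1 * w z + 1 * w (\<rho> z)) (\<lambda>z. 1 * w z + 1 * w (\<rho> z))"
  proof -
    have "2 * \<nu> * F z = w z + w (\<rho> z)" if "z \<in> X" for z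
    proof -
      from that obtain g k where z: "z = (g, k)" "g \<in> G" "k \<in> K"
        unfolding X_def by blast
      obtain g' k' where z': "\<rho> (g, k) = (g', k')" "k' \<in> K"
        using \<rho>(1)[of "(g, k)"] z by fastforce
      show ?thesis
        using ev[OF z(2,3)] z z' by (simp add: wM)
    qed
    then have "(\<Sum>z\<in>X. (2 * \<nu> * F z) * (2 * \<nu> * F z))
        = ip (\<lambda>z. 1 * w z + 1 * w (\<rho> z)) (\<lambda>z. 1 * w z + 1 * w (\<rho> z))"
      unfolding ip_def by (intro sum.cong) auto
    then show ?thesis
      by (simp add: ip_def power2_eq_square sum_distrib_left algebra_simps)
  qed
  also have "\<dots> = 2 * ip w w + 2 * ip w (\<lambda>z. w (\<rho> z))"
    unfolding ip_bilin using ip_comm[of w "\<lambda>z. w (\<rho> z)"] swap[of "\<lambda>z. w z * w z"]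
    by (simp add: ip_def)
  also have "\<dots> \<le> 2 * ip F F + 2 * (f * ip F F)"
  proof -
    have e_nonneg: "0 \<le> ip e e"
      unfolding ip_def by (intro sum_nonneg) simp
    have "y\<^sup>2 * ip e e \<le> 1 * ip e e"
      using y2 e_nonneg by (intro mult_right_mono) auto
    then have 1: "ip w w \<le> ip F F"
      using ww norm_F b_le by simp
    have "p + 2 * q + r \<le> f * (a + b / y\<^sup>2)"
      unfolding f_def by (rule reflection_form_le_zigzag_fun[OF form p xy])
    also have "\<dots> \<le> f * ip F F"
      using f b_le y2 norm_F by (intro mult_left_mono) (auto simp: field_simps)
    finally show ?thesis using 1 ww by simp
  qed
  finally have "\<nu>\<^sup>2 * ip F F \<le> (1 / 2 + 1 / 2 * f) * ip F F"
    by (simp add: algebra_simps)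
  moreover have "0 < ip F F"
  proof -
    from F(2) obtain z where "z \<in> X" "F z \<noteq> 0" by (auto simp: X_def)
    moreover have "finite X" using fin by (simp add: X_def)
    ultimately show ?thesis
      unfolding ip_def by (intro sum_pos2[of X z]) (auto simp: zero_less_mult_iff neq_iff)
  qed
  ultimately have "\<nu>\<^sup>2 \<le> 1 / 2 + 1 / 2 * f"
    by simp
  then show ?thesis
    unfolding f_def by (intro real_le_rsqrt) simp
qed

section \<open>The walk inside a cloud\<close>

lemma sum_square_sum:
  fixes p :: "'a \<Rightarrow> real" and q :: "'b \<Rightarrow> real"
  shows "(\<Sum>s\<in>S. \<Sum>t\<in>T. (p s + q t)\<^sup>2)
    = card T * (\<Sum>s\<in>S. (p s)\<^sup>2) + card S * (\<Sum>t\<in>T. (q t)\<^sup>2) + 2 * (sum p S * sum q T)"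
proof -
  have "(\<Sum>s\<in>S. \<Sum>t\<in>T. (p s + q t)\<^sup>2) = (\<Sum>s\<in>S. \<Sum>t\<in>T. (p s)\<^sup>2 + (q t)\<^sup>2 + 2 * (p s * q t))"
    by (intro sum.cong) (auto simp: power2_eq_square algebra_simps)
  also have "\<dots> = (\<Sum>s\<in>S. \<Sum>t\<in>T. (p s)\<^sup>2) + (\<Sum>s\<in>S. \<Sum>t\<in>T. (q t)\<^sup>2) + 2 * (\<Sum>s\<in>S. \<Sum>t\<in>T. p s * q t)"
    by (simp add: sum.distrib sum_distrib_left)
  finally show ?thesis
    unfolding sum_product by (simp add: sum_distrib_left)
qed

text \<open>(p s + q t) / d is the orthogonal projection of \<open>f\<close> on the sums of a
  function of s and a function of t; the grand total is subtracted in \<open>p\<close> so that it is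
  not counted twice. The left-hand side is the squared norm of p + q, and a projection does not
  increase the norm.\<close>

lemma marginals_square_le:
  fixes f :: "'a \<Rightarrow> 'b \<Rightarrow> real"
  assumes d: "card S = d" "card T = d" "0 < d"
  shows "d * (\<Sum>s\<in>S. (\<Sum>t\<in>T. f s t)\<^sup>2) + d * (\<Sum>t\<in>T. (\<Sum>s\<in>S. f s t)\<^sup>2) - (\<Sum>s\<in>S. \<Sum>t\<in>T. f s t)\<^sup>2
    \<le> (real d)\<^sup>2 * (\<Sum>s\<in>S. \<Sum>t\<in>T. (f s t)\<^sup>2)"
proof -
  define p where "p s = (\<Sum>t\<in>T. f s t) - (\<Sum>s\<in>S. \<Sum>t\<in>T. f s t) / d" for s
  define q where "q t = (\<Sum>s\<in>S. f s t)" for t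
  define m where "m = (\<Sum>s\<in>S. \<Sum>t\<in>T. f s t)"
  define A where "A = (\<Sum>s\<in>S. (\<Sum>t\<in>T. f s t)\<^sup>2)"
  define B where "B = (\<Sum>t\<in>T. (\<Sum>s\<in>S. f s t)\<^sup>2)"
  have sum_p: "sum p S = 0"
    using d by (simp add: p_def sum_subtractf)
  have "(\<Sum>s\<in>S. (p s)\<^sup>2) = (\<Sum>s\<in>S. (\<Sum>t\<in>T. f s t)\<^sup>2 - 2 * m / d * (\<Sum>t\<in>T. f s t) + (m / d)\<^sup>2)"
    by (intro sum.cong) (auto simp: p_def m_def[symmetric] power2_eq_square algebra_simps)
  also have "\<dots> = A - 2 * m / d * m + d * (m / d)\<^sup>2"
    using d by (simp add: sum.distrib sum_subtractf sum_distrib_left[symmetric] sum_divide_distrib[symmetric] A_def m_def)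
  finally have p2: "d * (\<Sum>s\<in>S. (p s)\<^sup>2) = d * A - m\<^sup>2"
    using d by (simp add: power2_eq_square field_simps)
  have fp: "(\<Sum>s\<in>S. \<Sum>t\<in>T. f s t * p s) = A - m\<^sup>2 / d"
  proof -
    have "(\<Sum>s\<in>S. \<Sum>t\<in>T. f s t * p s) = (\<Sum>s\<in>S. (\<Sum>t\<in>T. f s t)\<^sup>2 - m / d * (\<Sum>t\<in>T. f s t))"
      unfolding sum_distrib_right[symmetric]
      by (intro sum.cong) (auto simp: p_def m_def[symmetric] power2_eq_square algebra_simps)
    then show ?thesis
      by (simp add: sum_subtractf sum_distrib_left[symmetric] sum_divide_distrib[symmetric] A_def m_def power2_eq_square)
  qed
  have fq: "(\<Sum>s\<in>S. \<Sum>t\<in>T. f s t * q t) = B"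
    by (subst sum.swap) (simp add: q_def B_def sum_distrib_right[symmetric] power2_eq_square)
  have "0 \<le> (\<Sum>s\<in>S. \<Sum>t\<in>T. (d * f s t - (p s + q t))\<^sup>2)"
    by (intro sum_nonneg) auto
  also have "\<dots> = (\<Sum>s\<in>S. \<Sum>t\<in>T. d\<^sup>2 * (f s t)\<^sup>2 - 2 * d * (f s t * p s) - 2 * d * (f s t * q t) + (p s + q t)\<^sup>2)"
    by (intro sum.cong) (auto simp: power2_eq_square algebra_simps)
  also have "\<dots> = d\<^sup>2 * (\<Sum>s\<in>S. \<Sum>t\<in>T. (f s t)\<^sup>2) - 2 * d * (A - m\<^sup>2 / d) - 2 * d * B
      + (\<Sum>s\<in>S. \<Sum>t\<in>T. (p s + q t)\<^sup>2)"
    by (simp add: sum.distrib sum_subtractf sum_distrib_left[symmetric] fp fq)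
  also have "\<dots> = d\<^sup>2 * (\<Sum>s\<in>S. \<Sum>t\<in>T. (f s t)\<^sup>2) - 2 * d * (A - m\<^sup>2 / d) - 2 * d * B + (d * A - m\<^sup>2) + d * B"
    unfolding sum_square_sum sum_p d using p2 by (simp add: q_def B_def)
  also have "\<dots> = d\<^sup>2 * (\<Sum>s\<in>S. \<Sum>t\<in>T. (f s t)\<^sup>2) - d * A - d * B + m\<^sup>2"
    using d by (simp add: field_simps)
  finally show ?thesis
    unfolding A_def B_def m_def by simp
qed

text \<open>Edges are labels made of elements of the parts, not sets of vertices of the hypergraph:
  the same labels serve every cloud, and the pairs of cloud and edge form a product.\<close>

datatype ('a, 'b, 'c) tripartite_edge = Edge12 'a 'b | Edge13 'a 'c | Edge23 'b 'c

definition tripartite_edges :: "'a set \<Rightarrow> 'b set \<Rightarrow> 'c set \<Rightarrow> ('a, 'b, 'c) tripartite_edge set" where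
  "tripartite_edges S T U =
     (\<lambda>(s, t). Edge12 s t) ` (S \<times> T) \<union> ((\<lambda>(s, u). Edge13 s u) ` (S \<times> U) \<union> (\<lambda>(t, u). Edge23 t u) ` (T \<times> U))"

text \<open>\<open>linked\<close> edges are the distinct edges of a common triangle.\<close>

fun linked :: "('a, 'b, 'c) tripartite_edge \<Rightarrow> ('a, 'b, 'c) tripartite_edge \<Rightarrow> bool" where
  "linked (Edge12 s t) (Edge13 s' u) \<longleftrightarrow> s = s'"
| "linked (Edge12 s t) (Edge23 t' u) \<longleftrightarrow> t = t'"
| "linked (Edge13 s u) (Edge12 s' t) \<longleftrightarrow> s = s'"
| "linked (Edge13 s u) (Edge23 t u') \<longleftrightarrow> u = u'"
| "linked (Edge23 t u) (Edge12 s t') \<longleftrightarrow> t = t'"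
| "linked (Edge23 t u) (Edge13 s u') \<longleftrightarrow> u = u'"
| "linked _ _ \<longleftrightarrow> False"

lemma linked_sym: "linked k k' \<longleftrightarrow> linked k' k"
  by (cases k; cases k') auto

lemma mem_tripartite_edges [simp]:
  "Edge12 s t \<in> tripartite_edges S T U \<longleftrightarrow> s \<in> S \<and> t \<in> T"
  "Edge13 s u \<in> tripartite_edges S T U \<longleftrightarrow> s \<in> S \<and> u \<in> U"
  "Edge23 t u \<in> tripartite_edges S T U \<longleftrightarrow> t \<in> T \<and> u \<in> U"
  by (auto simp: tripartite_edges_def)

locale tripartite_graph =
  fixes S :: "'a set" and T :: "'b set" and U :: "'c set" and d :: nat
  assumes card_S: "card S = d" and card_T: "card T = d" and card_U: "card U = d" and d_pos: "0 < d"
begin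

abbreviation "K \<equiv> tripartite_edges S T U"

lemma finite_parts: "finite S" "finite T" "finite U"
  using card_S card_T card_U d_pos by (auto intro: card_ge_0_finite)

lemma finite_K: "finite K"
  unfolding tripartite_edges_def using finite_parts by auto

lemma sum_K:
  fixes f :: "('a, 'b, 'c) tripartite_edge \<Rightarrow> real"
  shows "sum f K = (\<Sum>s\<in>S. \<Sum>t\<in>T. f (Edge12 s t)) + (\<Sum>s\<in>S. \<Sum>u\<in>U. f (Edge13 s u)) + (\<Sum>t\<in>T. \<Sum>u\<in>U. f (Edge23 t u))"
proof -
  have "sum f K = sum f ((\<lambda>(s, t). Edge12 s t) ` (S \<times> T))
      + (sum f ((\<lambda>(s, u). Edge13 s u) ` (S \<times> U)) + sum f ((\<lambda>(t, u). Edge23 t u) ` (T \<times> U)))"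
    unfolding tripartite_edges_def using finite_parts
    by (subst sum.union_disjoint, (auto)[3], subst sum.union_disjoint) auto
  also have "sum f ((\<lambda>(s, t). Edge12 s t) ` (S \<times> T)) = (\<Sum>s\<in>S. \<Sum>t\<in>T. f (Edge12 s t))"
    by (subst sum.reindex) (auto simp: inj_on_def sum.cartesian_product intro!: sum.cong)
  also have "sum f ((\<lambda>(s, u). Edge13 s u) ` (S \<times> U)) = (\<Sum>s\<in>S. \<Sum>u\<in>U. f (Edge13 s u))"
    by (subst sum.reindex) (auto simp: inj_on_def sum.cartesian_product intro!: sum.cong)
  also have "sum f ((\<lambda>(t, u). Edge23 t u) ` (T \<times> U)) = (\<Sum>t\<in>T. \<Sum>u\<in>U. f (Edge23 t u))"
    by (subst sum.reindex) (auto simp: inj_on_def sum.cartesian_product intro!: sum.cong)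
  finally show ?thesis by simp
qed

lemma card_K: "real (card K) = 3 * (real d)\<^sup>2"
  using sum_K[of "\<lambda>_. 1"] card_S card_T card_U by (simp add: power2_eq_square)

definition N :: "('a, 'b, 'c) tripartite_edge \<Rightarrow> ('a, 'b, 'c) tripartite_edge \<Rightarrow> real" where
  "N k k' = of_bool (linked k k') / (2 * real d)"

lemma N_sym: "N k k' = N k' k"
  by (simp add: N_def linked_sym)

lemma sum_linked:
  fixes f :: "('a, 'b, 'c) tripartite_edge \<Rightarrow> real"
  shows "\<lbrakk>s \<in> S; t \<in> T\<rbrakk> \<Longrightarrow> (\<Sum>k\<in>K. N (Edge12 s t) k * f k)
      = ((\<Sum>u\<in>U. f (Edge13 s u)) + (\<Sum>u\<in>U. f (Edge23 t u))) / (2 * real d)"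
    and "\<lbrakk>s \<in> S; u \<in> U\<rbrakk> \<Longrightarrow> (\<Sum>k\<in>K. N (Edge13 s u) k * f k)
      = ((\<Sum>t\<in>T. f (Edge12 s t)) + (\<Sum>t\<in>T. f (Edge23 t u))) / (2 * real d)"
    and "\<lbrakk>t \<in> T; u \<in> U\<rbrakk> \<Longrightarrow> (\<Sum>k\<in>K. N (Edge23 t u) k * f k)
      = ((\<Sum>s\<in>S. f (Edge12 s t)) + (\<Sum>s\<in>S. f (Edge13 s u))) / (2 * real d)"
proof -
  have outer: "(\<Sum>x\<in>A. \<Sum>y\<in>B. of_bool (x0 = x) / (2 * real d) * g x y) = (\<Sum>y\<in>B. g x0 y) / (2 * real d)"
    if "finite A" "x0 \<in> A" for A :: "'x set" and B :: "'y set" and g x0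
  proof -
    have "(\<Sum>x\<in>A. \<Sum>y\<in>B. of_bool (x0 = x) / (2 * real d) * g x y)
        = (\<Sum>x\<in>A. if x0 = x then (\<Sum>y\<in>B. g x y) / (2 * real d) else 0)"
      by (intro sum.cong) (auto simp: sum_divide_distrib)
    then show ?thesis using that by simp
  qed
  have inner: "(\<Sum>x\<in>A. \<Sum>y\<in>B. of_bool (y0 = y) / (2 * real d) * g x y) = (\<Sum>x\<in>A. g x y0) / (2 * real d)"
    if "finite B" "y0 \<in> B" for A :: "'x set" and B :: "'y set" and g y0
    by (subst sum.swap) (rule outer[OF that])
  show "(\<Sum>k\<in>K. N (Edge12 s t) k * f k)
      = ((\<Sum>u\<in>U. f (Edge13 s u)) + (\<Sum>u\<in>U. f (Edge23 t u))) / (2 * real d)" if "s \<in> S" "t \<in> T"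
    unfolding sum_K N_def linked.simps using that finite_parts by (simp only: outer) (simp add: add_divide_distrib)
  show "(\<Sum>k\<in>K. N (Edge13 s u) k * f k)
      = ((\<Sum>t\<in>T. f (Edge12 s t)) + (\<Sum>t\<in>T. f (Edge23 t u))) / (2 * real d)" if "s \<in> S" "u \<in> U"
    unfolding sum_K N_def linked.simps using that finite_parts by (simp only: outer inner) (simp add: add_divide_distrib)
  show "(\<Sum>k\<in>K. N (Edge23 t u) k * f k)
      = ((\<Sum>s\<in>S. f (Edge12 s t)) + (\<Sum>s\<in>S. f (Edge13 s u))) / (2 * real d)" if "t \<in> T" "u \<in> U"
    unfolding sum_K N_def linked.simps using that finite_parts by (simp only: inner) (simp add: add_divide_distrib)
qed

lemma N_row: "k \<in> K \<Longrightarrow> (\<Sum>k'\<in>K. N k k') = 1"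
  using sum_linked[of _ _ "\<lambda>_. 1"] card_S card_T card_U d_pos by (cases k) auto

text \<open>Origin of the 1/2: a neighbour sum in the cloud is a sum of two marginals, so 4 d^2 |N
  f|^2 is a sum of squares of such sums. Expanded and regrouped by edge class, the squares are those
  of \<open>marginals_square_le\<close>, and since m12 + m13 + m23 = 0 the cross terms supply
  exactly the corrections - m12^2 - m13^2 - m23^2. The total is then at most d^2 |f|^2.\<close>

lemma N_contraction:
  assumes f: "sum f K = 0"
  shows "(\<Sum>k\<in>K. (\<Sum>k'\<in>K. N k k' * f k')\<^sup>2) \<le> (1 / 2)\<^sup>2 * (\<Sum>k\<in>K. (f k)\<^sup>2)"
proof -
  define D where "D = real d"
  have D: "0 < D" using d_pos by (simp add: D_def)
  define f12 f13 f23 where "f12 s t = f (Edge12 s t)" and "f13 s u = f (Edge13 s u)" and "f23 t u = f (Edge23 t u)"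
    for s t u
  define a12 b12 where "a12 s = (\<Sum>t\<in>T. f12 s t)" and "b12 t = (\<Sum>s\<in>S. f12 s t)" for s t
  define a13 b13 where "a13 s = (\<Sum>u\<in>U. f13 s u)" and "b13 u = (\<Sum>s\<in>S. f13 s u)" for s u
  define a23 b23 where "a23 t = (\<Sum>u\<in>U. f23 t u)" and "b23 u = (\<Sum>t\<in>T. f23 t u)" for t u
  define m12 m13 m23 where "m12 = sum a12 S" and "m13 = sum a13 S" and "m23 = sum a23 T"
  have b: "sum b12 T = m12" "sum b13 U = m13" "sum b23 U = m23"
    unfolding b12_def b13_def b23_def m12_def m13_def m23_def a12_def a13_def a23_def
    by (rule sum.swap)+
  have m: "m12 + m13 + m23 = 0"
    using f unfolding sum_K m12_def m13_def m23_def a12_def a13_def a23_def f12_def f13_def f23_def .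
  have "4 * D\<^sup>2 * (\<Sum>k\<in>K. (\<Sum>k'\<in>K. N k k' * f k')\<^sup>2)
      = (\<Sum>s\<in>S. \<Sum>t\<in>T. (a13 s + a23 t)\<^sup>2) + (\<Sum>s\<in>S. \<Sum>u\<in>U. (a12 s + b23 u)\<^sup>2) + (\<Sum>t\<in>T. \<Sum>u\<in>U. (b12 t + b13 u)\<^sup>2)"
  proof -
    have scale: "4 * D\<^sup>2 * (x / (2 * real d))\<^sup>2 = x\<^sup>2" for x
      using D by (simp add: D_def power_divide power_mult_distrib)
    show ?thesis
      unfolding sum_K[of "\<lambda>k. (\<Sum>k'\<in>K. N k k' * f k')\<^sup>2"] distrib_left sum_distrib_left
        a12_def b12_def a13_def b13_def a23_def b23_def f12_def f13_def f23_def
      by (intro arg_cong2[where f = "(+)"] sum.cong refl) (simp_all only: sum_linked scale)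
  qed
  also have "\<dots> = (D * (\<Sum>s\<in>S. (a12 s)\<^sup>2) + D * (\<Sum>t\<in>T. (b12 t)\<^sup>2) - m12\<^sup>2)
      + (D * (\<Sum>s\<in>S. (a13 s)\<^sup>2) + D * (\<Sum>u\<in>U. (b13 u)\<^sup>2) - m13\<^sup>2)
      + (D * (\<Sum>t\<in>T. (a23 t)\<^sup>2) + D * (\<Sum>u\<in>U. (b23 u)\<^sup>2) - m23\<^sup>2)"
  proof -
    have "(m12 + m13 + m23)\<^sup>2 = 0" using m by simp
    then have "2 * (m13 * m23) + 2 * (m12 * m23) + 2 * (m12 * m13) = - m12\<^sup>2 - m13\<^sup>2 - m23\<^sup>2"
      by (simp add: power2_eq_square algebra_simps)
    then show ?thesis
      unfolding sum_square_sum card_S card_T card_U b m12_def[symmetric] m13_def[symmetric] m23_def[symmetric] D_def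
      by simp
  qed
  also have "\<dots> \<le> D\<^sup>2 * (\<Sum>s\<in>S. \<Sum>t\<in>T. (f12 s t)\<^sup>2) + D\<^sup>2 * (\<Sum>s\<in>S. \<Sum>u\<in>U. (f13 s u)\<^sup>2) + D\<^sup>2 * (\<Sum>t\<in>T. \<Sum>u\<in>U. (f23 t u)\<^sup>2)"
    unfolding D_def a12_def b12_def a13_def b13_def a23_def b23_def m12_def m13_def m23_def
    using card_S card_T card_U d_pos by (intro add_mono marginals_square_le)
  also have "\<dots> = D\<^sup>2 * (\<Sum>k\<in>K. (f k)\<^sup>2)"
    unfolding sum_K f12_def f13_def f23_def by (simp add: distrib_left)
  finally have "D\<^sup>2 * (4 * (\<Sum>k\<in>K. (\<Sum>k'\<in>K. N k k' * f k')\<^sup>2)) \<le> D\<^sup>2 * (\<Sum>k\<in>K. (f k)\<^sup>2)"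
    by (simp add: algebra_simps)
  then have "4 * (\<Sum>k\<in>K. (\<Sum>k'\<in>K. N k k' * f k')\<^sup>2) \<le> (\<Sum>k\<in>K. (f k)\<^sup>2)"
    using D by simp
  then show ?thesis
    by (simp add: power2_eq_square)
qed

end

section \<open>The walk between clouds\<close>

lemma sum_mult_square_le:
  fixes f g :: "'v \<Rightarrow> real"
  shows "(\<Sum>v\<in>V. f v * g v)\<^sup>2 \<le> (\<Sum>v\<in>V. (f v)\<^sup>2) * (\<Sum>v\<in>V. (g v)\<^sup>2)"
proof (rule nonneg_form_discriminant)
  fix s t :: real
  have "0 \<le> (\<Sum>v\<in>V. (s * f v + t * g v)\<^sup>2)"
    by (intro sum_nonneg) simp
  also have "\<dots> = (\<Sum>v\<in>V. s\<^sup>2 * (f v)\<^sup>2 + 2 * s * t * (f v * g v) + t\<^sup>2 * (g v)\<^sup>2)"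
    by (intro sum.cong) (auto simp: power2_eq_square algebra_simps)
  finally show "0 \<le> s\<^sup>2 * (\<Sum>v\<in>V. (f v)\<^sup>2) + 2 * s * t * (\<Sum>v\<in>V. f v * g v) + t\<^sup>2 * (\<Sum>v\<in>V. (g v)\<^sup>2)"
    by (simp add: sum.distrib sum_distrib_left)
qed

lemma sum_mult_le:
  fixes f g :: "'v \<Rightarrow> real"
  assumes "(\<Sum>v\<in>V. (f v)\<^sup>2) \<le> c\<^sup>2 * n" "(\<Sum>v\<in>V. (g v)\<^sup>2) \<le> n" "0 \<le> c" "0 \<le> n"
  shows "(\<Sum>v\<in>V. f v * g v) \<le> c * n"
proof (rule power2_le_imp_le)
  have "(\<Sum>v\<in>V. f v * g v)\<^sup>2 \<le> (\<Sum>v\<in>V. (f v)\<^sup>2) * (\<Sum>v\<in>V. (g v)\<^sup>2)"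
    by (rule sum_mult_square_le)
  also have "\<dots> \<le> (c\<^sup>2 * n) * n"
    using assms by (intro mult_mono sum_nonneg) auto
  finally show "(\<Sum>v\<in>V. f v * g v)\<^sup>2 \<le> (c * n)\<^sup>2"
    by (simp add: power2_eq_square algebra_simps)
qed (use assms in simp)

section \<open>Symmetric stochastic kernels with a spectral gap\<close>

locale gap_kernel =
  fixes V :: "'v set" and k :: "'v \<Rightarrow> 'v \<Rightarrow> real" and c :: real
  assumes finite_V: "finite V" and V_ne: "V \<noteq> {}"
    and k_nonneg: "\<lbrakk>u \<in> V; v \<in> V\<rbrakk> \<Longrightarrow> 0 \<le> k u v"
    and k_sym: "\<lbrakk>u \<in> V; v \<in> V\<rbrakk> \<Longrightarrow> k u v = k v u"
    and k_row: "u \<in> V \<Longrightarrow> (\<Sum>v\<in>V. k u v) = 1"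
    and gap: "sum f V = 0 \<Longrightarrow> (\<Sum>u\<in>V. (\<Sum>v\<in>V. k u v * f v)\<^sup>2) \<le> c\<^sup>2 * (\<Sum>u\<in>V. (f u)\<^sup>2)"
begin

lemma k_col:
  assumes "v \<in> V"
  shows "(\<Sum>u\<in>V. k u v) = 1"
proof -
  have "(\<Sum>u\<in>V. k u v) = (\<Sum>u\<in>V. k v u)"
    using assms by (intro sum.cong refl k_sym)
  then show ?thesis using k_row[OF assms] by simp
qed

lemma sum_apply:
  fixes f :: "'v \<Rightarrow> real"
  shows "(\<Sum>u\<in>V. \<Sum>v\<in>V. k u v * f v) = sum f V"
proof -
  have "(\<Sum>u\<in>V. \<Sum>v\<in>V. k u v * f v) = (\<Sum>v\<in>V. (\<Sum>u\<in>V. k u v) * f v)"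
    unfolding sum_distrib_right by (rule sum.swap)
  then show ?thesis by (simp add: k_col)
qed

lemma apply_selfadjoint:
  fixes f g :: "'v \<Rightarrow> real"
  shows "(\<Sum>u\<in>V. f u * (\<Sum>v\<in>V. k u v * g v)) = (\<Sum>u\<in>V. (\<Sum>v\<in>V. k u v * f v) * g u)"
proof -
  have "(\<Sum>u\<in>V. f u * (\<Sum>v\<in>V. k u v * g v)) = (\<Sum>v\<in>V. \<Sum>u\<in>V. f u * (k u v * g v))"
    unfolding sum_distrib_left by (rule sum.swap)
  also have "\<dots> = (\<Sum>v\<in>V. \<Sum>u\<in>V. k v u * f u * g v)"
    using k_sym by (intro sum.cong) auto
  finally show ?thesis
    by (simp add: sum_distrib_right)
qed

text \<open>Jensen's inequality: the variance of \<open>f\<close> under the weights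
  \<open>k u\<close> is nonnegative. Summing over u costs nothing because the columns also sum to
  1.\<close>

lemma contraction:
  fixes f :: "'v \<Rightarrow> real"
  shows "(\<Sum>u\<in>V. (\<Sum>v\<in>V. k u v * f v)\<^sup>2) \<le> (\<Sum>u\<in>V. (f u)\<^sup>2)"
proof -
  have "(\<Sum>v\<in>V. k u v * f v)\<^sup>2 \<le> (\<Sum>v\<in>V. k u v * (f v)\<^sup>2)" if u: "u \<in> V" for u
  proof -
    define m where "m = (\<Sum>v\<in>V. k u v * f v)"
    have "0 \<le> (\<Sum>v\<in>V. k u v * (f v - m)\<^sup>2)"
      using k_nonneg u by (intro sum_nonneg) auto
    also have "\<dots> = (\<Sum>v\<in>V. k u v * (f v)\<^sup>2 - 2 * m * (k u v * f v) + m\<^sup>2 * k u v)"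
      by (intro sum.cong) (auto simp: power2_eq_square algebra_simps)
    also have "\<dots> = (\<Sum>v\<in>V. k u v * (f v)\<^sup>2) - 2 * m * m + m\<^sup>2"
      using k_row[OF u] by (simp add: sum.distrib sum_subtractf sum_distrib_left[symmetric] m_def)
    finally show ?thesis
      by (simp add: m_def power2_eq_square)
  qed
  then have "(\<Sum>u\<in>V. (\<Sum>v\<in>V. k u v * f v)\<^sup>2) \<le> (\<Sum>u\<in>V. \<Sum>v\<in>V. k u v * (f v)\<^sup>2)"
    by (intro sum_mono)
  then show ?thesis by (simp add: sum_apply)
qed

end

text \<open>The constant of a gap kernel is only an upper bound, so three kernels with different
  gaps can share the largest constant.\<close>

lemma gap_kernel_mono:
  assumes "gap_kernel V k c" "0 \<le> c" "c \<le> c'"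
  shows "gap_kernel V k c'"
proof -
  interpret gap_kernel V k c by fact
  have "(\<Sum>u\<in>V. (\<Sum>v\<in>V. k u v * f v)\<^sup>2) \<le> c'\<^sup>2 * (\<Sum>u\<in>V. (f u)\<^sup>2)" if "sum f V = 0" for f
  proof -
    have "(\<Sum>u\<in>V. (\<Sum>v\<in>V. k u v * f v)\<^sup>2) \<le> c\<^sup>2 * (\<Sum>u\<in>V. (f u)\<^sup>2)"
      by (rule gap[OF that])
    also have "\<dots> \<le> c'\<^sup>2 * (\<Sum>u\<in>V. (f u)\<^sup>2)"
      using assms by (intro mult_right_mono power_mono sum_nonneg) auto
    finally show ?thesis .
  qed
  then show ?thesis
    using finite_V V_ne k_nonneg k_sym k_row by unfold_locales
qed

text \<open>Origin of 1 + 2 c: the function with the small norm occurs in two of the three products,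
  and each of these is at most c n by Cauchy--Schwarz; the remaining product is only at most
  n.\<close>

lemma sum_pairs_le:
  fixes p1 p2 p3 :: "'v \<Rightarrow> real"
  assumes n: "0 \<le> n" and c: "0 \<le> c"
    and p: "(\<Sum>v\<in>V. (p1 v)\<^sup>2) \<le> n" "(\<Sum>v\<in>V. (p2 v)\<^sup>2) \<le> n" "(\<Sum>v\<in>V. (p3 v)\<^sup>2) \<le> n"
    and gap: "(\<Sum>v\<in>V. (p1 v)\<^sup>2) \<le> c\<^sup>2 * n \<or> (\<Sum>v\<in>V. (p2 v)\<^sup>2) \<le> c\<^sup>2 * n \<or> (\<Sum>v\<in>V. (p3 v)\<^sup>2) \<le> c\<^sup>2 * n"
  shows "(\<Sum>v\<in>V. p1 v * p2 v) + (\<Sum>v\<in>V. p1 v * p3 v) + (\<Sum>v\<in>V. p2 v * p3 v) \<le> (1 + 2 * c) * n"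
proof -
  have general: "(\<Sum>v\<in>V. p v * q v) + (\<Sum>v\<in>V. p v * r v) + (\<Sum>v\<in>V. q v * r v) \<le> (1 + 2 * c) * n"
    if "(\<Sum>v\<in>V. (p v)\<^sup>2) \<le> c\<^sup>2 * n" "(\<Sum>v\<in>V. (q v)\<^sup>2) \<le> n" "(\<Sum>v\<in>V. (r v)\<^sup>2) \<le> n" for p q r :: "'v \<Rightarrow> real"
    using sum_mult_le[OF that(1,2) c n] sum_mult_le[OF that(1,3) c n] sum_mult_le[of q V 1 n r] that n
    by (simp add: algebra_simps)
  from gap show ?thesis
  proof (elim disjE)
    assume "(\<Sum>v\<in>V. (p1 v)\<^sup>2) \<le> c\<^sup>2 * n"
    then show ?thesis using general[of p1 p2 p3] p by simp
  next
    assume "(\<Sum>v\<in>V. (p2 v)\<^sup>2) \<le> c\<^sup>2 * n"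
    then show ?thesis using general[of p2 p1 p3] p by (simp add: mult.commute)
  next
    assume "(\<Sum>v\<in>V. (p3 v)\<^sup>2) \<le> c\<^sup>2 * n"
    then show ?thesis using general[of p3 p1 p2] p by (simp add: mult.commute)
  qed
qed

section \<open>Three kernels acting on the coordinates of a product\<close>

locale three_gap_kernels =
  A: gap_kernel V1 k1 c + B: gap_kernel V2 k2 c + C: gap_kernel V3 k3 c
  for V1 :: "'a set" and V2 :: "'b set" and V3 :: "'c set" and k1 k2 k3 and c :: real +
  assumes c_nonneg: "0 \<le> c"
begin

abbreviation "\<Omega> \<equiv> V1 \<times> V2 \<times> V3"

definition L1 :: "('a \<times> 'b \<times> 'c \<Rightarrow> real) \<Rightarrow> 'a \<times> 'b \<times> 'c \<Rightarrow> real" where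
  "L1 \<phi> = (\<lambda>(x, y, z). \<Sum>x'\<in>V1. k1 x x' * \<phi> (x', y, z))"

definition L2 :: "('a \<times> 'b \<times> 'c \<Rightarrow> real) \<Rightarrow> 'a \<times> 'b \<times> 'c \<Rightarrow> real" where
  "L2 \<phi> = (\<lambda>(x, y, z). \<Sum>y'\<in>V2. k2 y y' * \<phi> (x, y', z))"

definition L3 :: "('a \<times> 'b \<times> 'c \<Rightarrow> real) \<Rightarrow> 'a \<times> 'b \<times> 'c \<Rightarrow> real" where
  "L3 \<phi> = (\<lambda>(x, y, z). \<Sum>z'\<in>V3. k3 z z' * \<phi> (x, y, z'))"

lemma sum_\<Omega>:
  fixes h :: "'a \<times> 'b \<times> 'c \<Rightarrow> real"
  shows "sum h \<Omega> = (\<Sum>y\<in>V2. \<Sum>z\<in>V3. \<Sum>x\<in>V1. h (x, y, z))"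
    and "sum h \<Omega> = (\<Sum>x\<in>V1. \<Sum>z\<in>V3. \<Sum>y\<in>V2. h (x, y, z))"
    and "sum h \<Omega> = (\<Sum>x\<in>V1. \<Sum>y\<in>V2. \<Sum>z\<in>V3. h (x, y, z))"
proof -
  show 3: "sum h \<Omega> = (\<Sum>x\<in>V1. \<Sum>y\<in>V2. \<Sum>z\<in>V3. h (x, y, z))"
    by (simp add: sum.cartesian_product)
  show 2: "sum h \<Omega> = (\<Sum>x\<in>V1. \<Sum>z\<in>V3. \<Sum>y\<in>V2. h (x, y, z))"
    unfolding 3 by (intro sum.cong refl sum.swap)
  have "(\<Sum>x\<in>V1. \<Sum>y\<in>V2. \<Sum>z\<in>V3. h (x, y, z)) = (\<Sum>y\<in>V2. \<Sum>x\<in>V1. \<Sum>z\<in>V3. h (x, y, z))"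
    by (rule sum.swap)
  also have "\<dots> = (\<Sum>y\<in>V2. \<Sum>z\<in>V3. \<Sum>x\<in>V1. h (x, y, z))"
    by (intro sum.cong refl sum.swap)
  finally show "sum h \<Omega> = (\<Sum>y\<in>V2. \<Sum>z\<in>V3. \<Sum>x\<in>V1. h (x, y, z))"
    unfolding 3 .
qed

lemma L_contraction:
  "(\<Sum>w\<in>\<Omega>. (L1 \<phi> w)\<^sup>2) \<le> (\<Sum>w\<in>\<Omega>. (\<phi> w)\<^sup>2)"
  "(\<Sum>w\<in>\<Omega>. (L2 \<phi> w)\<^sup>2) \<le> (\<Sum>w\<in>\<Omega>. (\<phi> w)\<^sup>2)"
  "(\<Sum>w\<in>\<Omega>. (L3 \<phi> w)\<^sup>2) \<le> (\<Sum>w\<in>\<Omega>. (\<phi> w)\<^sup>2)"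
  unfolding L1_def L2_def L3_def case_prod_conv
    sum_\<Omega>(1)[of "\<lambda>w. (case w of (x, y, z) \<Rightarrow> \<Sum>x'\<in>V1. k1 x x' * \<phi> (x', y, z))\<^sup>2"]
    sum_\<Omega>(2)[of "\<lambda>w. (case w of (x, y, z) \<Rightarrow> \<Sum>y'\<in>V2. k2 y y' * \<phi> (x, y', z))\<^sup>2"]
    sum_\<Omega>(3)[of "\<lambda>w. (case w of (x, y, z) \<Rightarrow> \<Sum>z'\<in>V3. k3 z z' * \<phi> (x, y, z'))\<^sup>2"]
  subgoal unfolding sum_\<Omega>(1) by (intro sum_mono A.contraction)
  subgoal unfolding sum_\<Omega>(2) by (intro sum_mono B.contraction)
  subgoal unfolding sum_\<Omega>(3) by (intro sum_mono C.contraction)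
  done

lemma L_gap:
  "(\<And>y z. (\<Sum>x\<in>V1. \<phi> (x, y, z)) = 0) \<Longrightarrow> (\<Sum>w\<in>\<Omega>. (L1 \<phi> w)\<^sup>2) \<le> c\<^sup>2 * (\<Sum>w\<in>\<Omega>. (\<phi> w)\<^sup>2)"
  "(\<And>x z. (\<Sum>y\<in>V2. \<phi> (x, y, z)) = 0) \<Longrightarrow> (\<Sum>w\<in>\<Omega>. (L2 \<phi> w)\<^sup>2) \<le> c\<^sup>2 * (\<Sum>w\<in>\<Omega>. (\<phi> w)\<^sup>2)"
  "(\<And>x y. (\<Sum>z\<in>V3. \<phi> (x, y, z)) = 0) \<Longrightarrow> (\<Sum>w\<in>\<Omega>. (L3 \<phi> w)\<^sup>2) \<le> c\<^sup>2 * (\<Sum>w\<in>\<Omega>. (\<phi> w)\<^sup>2)"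
  unfolding L1_def L2_def L3_def case_prod_conv
    sum_\<Omega>(1)[of "\<lambda>w. (case w of (x, y, z) \<Rightarrow> \<Sum>x'\<in>V1. k1 x x' * \<phi> (x', y, z))\<^sup>2"]
    sum_\<Omega>(2)[of "\<lambda>w. (case w of (x, y, z) \<Rightarrow> \<Sum>y'\<in>V2. k2 y y' * \<phi> (x, y', z))\<^sup>2"]
    sum_\<Omega>(3)[of "\<lambda>w. (case w of (x, y, z) \<Rightarrow> \<Sum>z'\<in>V3. k3 z z' * \<phi> (x, y, z'))\<^sup>2"]
  subgoal unfolding sum_\<Omega>(1) sum_distrib_left[of "c\<^sup>2"] unfolding sum_distrib_left[symmetric, of "c\<^sup>2" _ V1]
    by (intro sum_mono A.gap)
  subgoal unfolding sum_\<Omega>(2) sum_distrib_left[of "c\<^sup>2"] unfolding sum_distrib_left[symmetric, of "c\<^sup>2" _ V2]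
    by (intro sum_mono B.gap)
  subgoal unfolding sum_\<Omega>(3) sum_distrib_left[of "c\<^sup>2"] unfolding sum_distrib_left[symmetric, of "c\<^sup>2" _ V3]
    by (intro sum_mono C.gap)
  done

lemma L_add:
  "L1 (\<lambda>w. \<phi> w + \<psi> w) w = L1 \<phi> w + L1 \<psi> w"
  "L2 (\<lambda>w. \<phi> w + \<psi> w) w = L2 \<phi> w + L2 \<psi> w"
  "L3 (\<lambda>w. \<phi> w + \<psi> w) w = L3 \<phi> w + L3 \<psi> w"
  by (cases w; simp add: L1_def L2_def L3_def distrib_left sum.distrib)+

text \<open>The other coordinates range over their whole types and not only over \<open>V2\<close>
  and \<open>V3\<close>. The parts into which functions are split satisfy this stronger condition,
  and it needs no membership side conditions.\<close>

definition zero1 :: "('a \<times> 'b \<times> 'c \<Rightarrow> real) \<Rightarrow> bool" where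
  "zero1 \<phi> \<longleftrightarrow> (\<forall>y z. (\<Sum>x\<in>V1. \<phi> (x, y, z)) = 0)"

definition const1 :: "('a \<times> 'b \<times> 'c \<Rightarrow> real) \<Rightarrow> bool" where
  "const1 \<phi> \<longleftrightarrow> (\<forall>x\<in>V1. \<forall>x'\<in>V1. \<forall>y z. \<phi> (x, y, z) = \<phi> (x', y, z))"

definition zero2 :: "('a \<times> 'b \<times> 'c \<Rightarrow> real) \<Rightarrow> bool" where
  "zero2 \<phi> \<longleftrightarrow> (\<forall>x z. (\<Sum>y\<in>V2. \<phi> (x, y, z)) = 0)"

definition const2 :: "('a \<times> 'b \<times> 'c \<Rightarrow> real) \<Rightarrow> bool" where
  "const2 \<phi> \<longleftrightarrow> (\<forall>y\<in>V2. \<forall>y'\<in>V2. \<forall>x z. \<phi> (x, y, z) = \<phi> (x, y', z))"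

text \<open>An average over another coordinate commutes with summation over the first, and the
  average over the first preserves that sum because the columns of its kernel sum to 1.\<close>

lemma zero1_L: "zero1 \<phi> \<Longrightarrow> zero1 (L1 \<phi>)" "zero1 \<phi> \<Longrightarrow> zero1 (L2 \<phi>)" "zero1 \<phi> \<Longrightarrow> zero1 (L3 \<phi>)"
  unfolding zero1_def L1_def L2_def L3_def case_prod_conv
  subgoal by (simp add: A.sum_apply)
  subgoal by (subst sum.swap) (simp add: sum_distrib_left[symmetric])
  subgoal by (subst sum.swap) (simp add: sum_distrib_left[symmetric])
  done

lemma zero2_L: "zero2 \<phi> \<Longrightarrow> zero2 (L1 \<phi>)" "zero2 \<phi> \<Longrightarrow> zero2 (L2 \<phi>)" "zero2 \<phi> \<Longrightarrow> zero2 (L3 \<phi>)"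
  unfolding zero2_def L1_def L2_def L3_def case_prod_conv
  subgoal by (subst sum.swap) (simp add: sum_distrib_left[symmetric])
  subgoal by (simp add: B.sum_apply)
  subgoal by (subst sum.swap) (simp add: sum_distrib_left[symmetric])
  done

lemma const1_L: "const1 \<phi> \<Longrightarrow> const1 (L1 \<phi>)" "const1 \<phi> \<Longrightarrow> const1 (L2 \<phi>)" "const1 \<phi> \<Longrightarrow> const1 (L3 \<phi>)"
proof -
  assume \<phi>: "const1 \<phi>"
  have eq: "L1 \<phi> (x, y, z) = \<phi> (x, y, z)" if "x \<in> V1" for x y z
  proof -
    have "L1 \<phi> (x, y, z) = (\<Sum>x'\<in>V1. k1 x x' * \<phi> (x, y, z))"
      unfolding L1_def case_prod_conv using \<phi> that unfolding const1_def
      by (intro sum.cong refl arg_cong2[where f = "(*)"]) blast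
    then show ?thesis
      using A.k_row[OF that] by (simp add: sum_distrib_right[symmetric])
  qed
  show "const1 (L1 \<phi>)"
    unfolding const1_def
  proof (intro ballI allI)
    fix x x' y z assume "x \<in> V1" "x' \<in> V1"
    then show "L1 \<phi> (x, y, z) = L1 \<phi> (x', y, z)"
      using eq \<phi>[unfolded const1_def, rule_format, of x x'] by presburger
  qed
  show "const1 (L2 \<phi>)" "const1 (L3 \<phi>)"
    using \<phi> unfolding const1_def L2_def L3_def case_prod_conv
    by (intro ballI allI sum.cong refl arg_cong2[where f = "(*)"]; blast)+
qed

lemma const2_L: "const2 \<phi> \<Longrightarrow> const2 (L1 \<phi>)" "const2 \<phi> \<Longrightarrow> const2 (L2 \<phi>)" "const2 \<phi> \<Longrightarrow> const2 (L3 \<phi>)"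
proof -
  assume \<phi>: "const2 \<phi>"
  have eq: "L2 \<phi> (x, y, z) = \<phi> (x, y, z)" if "y \<in> V2" for x y z
  proof -
    have "L2 \<phi> (x, y, z) = (\<Sum>y'\<in>V2. k2 y y' * \<phi> (x, y, z))"
      unfolding L2_def case_prod_conv using \<phi> that unfolding const2_def
      by (intro sum.cong refl arg_cong2[where f = "(*)"]) blast
    then show ?thesis
      using B.k_row[OF that] by (simp add: sum_distrib_right[symmetric])
  qed
  show "const2 (L2 \<phi>)"
    unfolding const2_def
  proof (intro ballI allI)
    fix y y' x z assume "y \<in> V2" "y' \<in> V2"
    then show "L2 \<phi> (x, y, z) = L2 \<phi> (x, y', z)"
      using eq \<phi>[unfolded const2_def, rule_format, of y y'] by presburger
  qed
  show "const2 (L1 \<phi>)" "const2 (L3 \<phi>)"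
    using \<phi> unfolding const2_def L1_def L3_def case_prod_conv
    by (intro ballI allI sum.cong refl arg_cong2[where f = "(*)"]; blast)+
qed

lemma orthogonal1:
  assumes "zero1 \<phi>" "const1 \<psi>"
  shows "(\<Sum>w\<in>\<Omega>. \<phi> w * \<psi> w) = 0"
proof -
  obtain x0 where x0: "x0 \<in> V1" using A.V_ne by blast
  have "(\<Sum>x\<in>V1. \<phi> (x, y, z) * \<psi> (x, y, z)) = 0" for y z
  proof -
    have "(\<Sum>x\<in>V1. \<phi> (x, y, z) * \<psi> (x, y, z)) = (\<Sum>x\<in>V1. \<phi> (x, y, z) * \<psi> (x0, y, z))"
      using assms(2) x0 unfolding const1_def by (intro sum.cong refl arg_cong2[where f = "(*)"]) blast
    then show ?thesis
      using assms(1) by (simp add: zero1_def sum_distrib_right[symmetric])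
  qed
  then show ?thesis unfolding sum_\<Omega>(1) by simp
qed

lemma orthogonal2:
  assumes "zero2 \<phi>" "const2 \<psi>"
  shows "(\<Sum>w\<in>\<Omega>. \<phi> w * \<psi> w) = 0"
proof -
  obtain y0 where y0: "y0 \<in> V2" using B.V_ne by blast
  have "(\<Sum>y\<in>V2. \<phi> (x, y, z) * \<psi> (x, y, z)) = 0" for x z
  proof -
    have "(\<Sum>y\<in>V2. \<phi> (x, y, z) * \<psi> (x, y, z)) = (\<Sum>y\<in>V2. \<phi> (x, y, z) * \<psi> (x, y0, z))"
      using assms(2) y0 unfolding const2_def by (intro sum.cong refl arg_cong2[where f = "(*)"]) blast
    then show ?thesis
      using assms(1) by (simp add: zero2_def sum_distrib_right[symmetric])
  qed
  then show ?thesis unfolding sum_\<Omega>(2) by simp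
qed

text \<open>This is the quadratic form of L1 L2 + L1 L3 + L2 L3, with the first factor of each
  product moved to the other side by self-adjointness, so that Cauchy--Schwarz applies to single
  averages.\<close>

definition pair_form :: "('a \<times> 'b \<times> 'c \<Rightarrow> real) \<Rightarrow> real" where
  "pair_form \<phi> = (\<Sum>w\<in>\<Omega>. L1 \<phi> w * L2 \<phi> w) + (\<Sum>w\<in>\<Omega>. L1 \<phi> w * L3 \<phi> w) + (\<Sum>w\<in>\<Omega>. L2 \<phi> w * L3 \<phi> w)"

text \<open>The conditions on both summands are invariant under all three averages, so every cross
  term pairs a function of mean zero in a coordinate with one that is constant in it.\<close>

lemma pair_form_add:
  assumes "zero1 \<phi> \<and> const1 \<psi> \<or> zero2 \<phi> \<and> const2 \<psi>"
  shows "pair_form (\<lambda>w. \<phi> w + \<psi> w) = pair_form \<phi> + pair_form \<psi>"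
    and "(\<Sum>w\<in>\<Omega>. (\<phi> w + \<psi> w)\<^sup>2) = (\<Sum>w\<in>\<Omega>. (\<phi> w)\<^sup>2) + (\<Sum>w\<in>\<Omega>. (\<psi> w)\<^sup>2)"
proof -
  have expand: "(\<Sum>w\<in>\<Omega>. (p w + p' w) * (q w + q' w)) = (\<Sum>w\<in>\<Omega>. p w * q w) + (\<Sum>w\<in>\<Omega>. p' w * q' w)"
    if "(\<Sum>w\<in>\<Omega>. p w * q' w) = 0" "(\<Sum>w\<in>\<Omega>. q w * p' w) = 0" for p q p' q' :: "'a \<times> 'b \<times> 'c \<Rightarrow> real"
    using that by (simp add: distrib_left distrib_right sum.distrib mult.commute)
  have orth: "(\<Sum>w\<in>\<Omega>. p w * q w) = 0"
    if "p \<in> {L1 \<phi>, L2 \<phi>, L3 \<phi>}" "q \<in> {L1 \<psi>, L2 \<psi>, L3 \<psi>}" for p q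
    using assms that
    by (auto intro: orthogonal1 orthogonal2 simp: zero1_L zero2_L const1_L const2_L)
  show "pair_form (\<lambda>w. \<phi> w + \<psi> w) = pair_form \<phi> + pair_form \<psi>"
    unfolding pair_form_def L_add
    by (simp add: expand orth)
  show "(\<Sum>w\<in>\<Omega>. (\<phi> w + \<psi> w)\<^sup>2) = (\<Sum>w\<in>\<Omega>. (\<phi> w)\<^sup>2) + (\<Sum>w\<in>\<Omega>. (\<psi> w)\<^sup>2)"
    unfolding power2_eq_square using assms by (intro expand) (auto intro: orthogonal1 orthogonal2)
qed

lemma pair_form_le_part:
  assumes "zero1 \<phi> \<or> zero2 \<phi> \<or> (\<forall>x y. (\<Sum>z\<in>V3. \<phi> (x, y, z)) = 0)"
  shows "pair_form \<phi> \<le> (1 + 2 * c) * (\<Sum>w\<in>\<Omega>. (\<phi> w)\<^sup>2)"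
  unfolding pair_form_def
proof (rule sum_pairs_le[OF _ c_nonneg L_contraction])
  show "0 \<le> (\<Sum>w\<in>\<Omega>. (\<phi> w)\<^sup>2)" by (simp add: sum_nonneg)
  show "(\<Sum>w\<in>\<Omega>. (L1 \<phi> w)\<^sup>2) \<le> c\<^sup>2 * (\<Sum>w\<in>\<Omega>. (\<phi> w)\<^sup>2) \<or> (\<Sum>w\<in>\<Omega>. (L2 \<phi> w)\<^sup>2) \<le> c\<^sup>2 * (\<Sum>w\<in>\<Omega>. (\<phi> w)\<^sup>2)
      \<or> (\<Sum>w\<in>\<Omega>. (L3 \<phi> w)\<^sup>2) \<le> c\<^sup>2 * (\<Sum>w\<in>\<Omega>. (\<phi> w)\<^sup>2)"
    using assms L_gap[of \<phi>] unfolding zero1_def zero2_def by blast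
qed

text \<open>Split \<open>\<phi>\<close> into a part with mean zero in the first coordinate, a part that is constant in the first
  and has mean zero in the second one, and a part that depends on the third coordinate only.\<close>

lemma pair_form_le:
  assumes \<phi>: "sum \<phi> \<Omega> = 0"
  shows "pair_form \<phi> \<le> (1 + 2 * c) * (\<Sum>w\<in>\<Omega>. (\<phi> w)\<^sup>2)"
proof -
  define m1 where "m1 y z = (\<Sum>x\<in>V1. \<phi> (x, y, z)) / card V1" for y z
  define m2 where "m2 z = (\<Sum>y\<in>V2. m1 y z) / card V2" for z
  define u1 where "u1 = (\<lambda>(x, y, z). \<phi> (x, y, z) - m1 y z)"
  define u2 :: "'a \<times> 'b \<times> 'c \<Rightarrow> real" where "u2 = (\<lambda>(x, y, z). m1 y z - m2 z)"
  define u3 :: "'a \<times> 'b \<times> 'c \<Rightarrow> real" where "u3 = (\<lambda>(x, y, z). m2 z)"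
  have cards: "real (card V1) \<noteq> 0" "real (card V2) \<noteq> 0"
    using A.finite_V A.V_ne B.finite_V B.V_ne by auto
  have parts: "zero1 u1" "const1 (\<lambda>w. u2 w + u3 w)" "zero2 u2" "const2 u3"
    using cards by (auto simp: zero1_def const1_def zero2_def const2_def u1_def u2_def u3_def sum_subtractf m1_def m2_def)
  \<comment> \<open>The vanishing total of \<open>\<phi>\<close> enters here, for the last part; the
    other two have mean zero in a coordinate by the subtraction of averages.\<close>
  have "(\<Sum>z\<in>V3. m2 z) = (\<Sum>z\<in>V3. \<Sum>y\<in>V2. \<Sum>x\<in>V1. \<phi> (x, y, z)) / card V1 / card V2"
    by (simp add: m2_def m1_def sum_divide_distrib)
  also have "(\<Sum>z\<in>V3. \<Sum>y\<in>V2. \<Sum>x\<in>V1. \<phi> (x, y, z)) = sum \<phi> \<Omega>"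
    unfolding sum_\<Omega>(1) by (rule sum.swap)
  finally have zero3: "\<forall>x y. (\<Sum>z\<in>V3. u3 (x, y, z)) = 0"
    using \<phi> by (simp add: u3_def)
  have split_w: "\<phi> w = u1 w + (u2 w + u3 w)" for w
    by (cases w) (simp add: u1_def u2_def u3_def)
  then have "\<phi> = (\<lambda>w. u1 w + (u2 w + u3 w))"
    by (simp add: fun_eq_iff)
  then have "pair_form \<phi> = pair_form (\<lambda>w. u1 w + (u2 w + u3 w))"
    by (rule arg_cong)
  also have "\<dots> = pair_form u1 + (pair_form u2 + pair_form u3)"
    by (simp add: pair_form_add parts)
  also have "\<dots> \<le> (1 + 2 * c) * (\<Sum>w\<in>\<Omega>. (u1 w)\<^sup>2)
      + ((1 + 2 * c) * (\<Sum>w\<in>\<Omega>. (u2 w)\<^sup>2) + (1 + 2 * c) * (\<Sum>w\<in>\<Omega>. (u3 w)\<^sup>2))"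
    using parts zero3 by (intro add_mono pair_form_le_part) auto
  also have "\<dots> = (1 + 2 * c) * (\<Sum>w\<in>\<Omega>. (u1 w + (u2 w + u3 w))\<^sup>2)"
    using parts by (simp add: pair_form_add distrib_left)
  finally show ?thesis
    unfolding split_w .
qed

lemma L_selfadjoint:
  "(\<Sum>w\<in>\<Omega>. \<phi> w * L1 \<psi> w) = (\<Sum>w\<in>\<Omega>. L1 \<phi> w * \<psi> w)"
  "(\<Sum>w\<in>\<Omega>. \<phi> w * L2 \<psi> w) = (\<Sum>w\<in>\<Omega>. L2 \<phi> w * \<psi> w)"
  unfolding L1_def L2_def
  subgoal unfolding sum_\<Omega>(1) case_prod_conv by (intro sum.cong refl A.apply_selfadjoint)
  subgoal unfolding sum_\<Omega>(2) case_prod_conv by (intro sum.cong refl B.apply_selfadjoint)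
  done

end

section \<open>Regular graphs and Cayley graphs as gap kernels\<close>

lemma regular_graph_gap_kernel:
  assumes V: "finite V" "V \<noteq> {}" and D: "0 < D" and deg: "\<And>u. u \<in> V \<Longrightarrow> degree_in V E u = D"
  shows "gap_kernel V (\<lambda>u v. of_bool ({u, v} \<in> E) / real D) (graph_lambda V E)"
proof
  have apply_eq: "(\<Sum>v\<in>V. of_bool ({u, v} \<in> E) / real D * f v) = (\<Sum>v | v \<in> V \<and> {u, v} \<in> E. f v) / D"
    for u and f :: "'a \<Rightarrow> real"
    unfolding sum_divide_distrib using V(1) by (intro sum.mono_neutral_cong_right) auto
  show row: "(\<Sum>v\<in>V. of_bool ({u, v} \<in> E) / real D) = 1" if "u \<in> V" for u
    using apply_eq[of u "\<lambda>_. 1"] deg[OF that] D by (simp add: degree_in_def)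
  show sym: "of_bool ({u, v} \<in> E) / real D = of_bool ({v, u} \<in> E) / real D" for u v
    by (simp add: insert_commute)
  show "(\<Sum>u\<in>V. (\<Sum>v\<in>V. of_bool ({u, v} \<in> E) / real D * f v)\<^sup>2)
      \<le> (graph_lambda V E)\<^sup>2 * (\<Sum>u\<in>V. (f u)\<^sup>2)" if "sum f V = 0" for f
  proof (rule symmetric_kernel_norm_le[OF V(1) sym row _ that])
    fix \<mu> and f :: "'a \<Rightarrow> real"
    assume f: "\<exists>u\<in>V. f u \<noteq> 0" "sum f V = 0"
      and ev: "\<And>u. u \<in> V \<Longrightarrow> (\<Sum>v\<in>V. of_bool ({u, v} \<in> E) / real D * f v) = \<mu> * f u"
    have "(\<Sum>v | v \<in> V \<and> {u, v} \<in> E. f v) = real D * \<mu> * f u" if "u \<in> V" for u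
      using ev[OF that] D unfolding apply_eq by (simp add: field_simps)
    with V(1) D deg f show "\<bar>\<mu>\<bar> \<le> graph_lambda V E"
      by (intro eigenvalue_le_graph_lambda[of V D E f \<mu>])
  qed
qed (use V in auto)

text \<open>Edges are unordered, so u may be either end of {g, s g}. As the second end it gives v =
  inv s u, which is of the required form because the set is closed under inverses.\<close>

lemma (in group) cayley_neighbours:
  assumes S: "S \<subseteq> carrier G" "S = set_inv S" and u: "u \<in> carrier G"
  shows "{v. v \<in> carrier G \<and> {u, v} \<in> cayley_edges G S} = (\<lambda>s. s \<otimes> u) ` S"
proof (intro equalityI subsetI)
  fix v assume "v \<in> {v. v \<in> carrier G \<and> {u, v} \<in> cayley_edges G S}"
  then obtain g s where v: "v \<in> carrier G" and gs: "g \<in> carrier G" "s \<in> S" "{u, v} = {g, s \<otimes> g}"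
    unfolding cayley_edges_def by blast
  from gs(3) consider "u = g" "v = s \<otimes> g" | "u = s \<otimes> g" "v = g"
    by (auto simp: doubleton_eq_iff)
  then show "v \<in> (\<lambda>s. s \<otimes> u) ` S"
  proof cases
    case 1
    then show ?thesis using gs by blast
  next
    case 2
    have "inv s \<in> S"
      using S(2) gs(2) by (auto simp: SET_INV_def)
    moreover have "v = inv s \<otimes> u"
      using 2 gs S(1) by (simp add: inv_solve_left subsetD)
    ultimately show ?thesis by blast
  qed
next
  fix v assume "v \<in> (\<lambda>s. s \<otimes> u) ` S"
  then show "v \<in> {v. v \<in> carrier G \<and> {u, v} \<in> cayley_edges G S}"
    unfolding cayley_edges_def using S(1) u by auto
qed

lemma (in group) inj_on_translation:
  "S \<subseteq> carrier G \<Longrightarrow> u \<in> carrier G \<Longrightarrow> inj_on (\<lambda>s. s \<otimes> u) S"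
  by (auto simp: inj_on_def subsetD)

lemma (in group) cayley_gap_kernel:
  assumes fin: "finite (carrier G)" and S: "S \<subseteq> carrier G" "S = set_inv S" and d: "card S = d" "0 < d"
  shows "gap_kernel (carrier G) (\<lambda>u v. of_bool ({u, v} \<in> cayley_edges G S) / real d) (cayley_lambda G S)"
    and "u \<in> carrier G \<Longrightarrow> (\<Sum>v\<in>carrier G. of_bool ({u, v} \<in> cayley_edges G S) / real d * f v)
      = (\<Sum>s\<in>S. f (s \<otimes> u)) / d"
proof -
  show "gap_kernel (carrier G) (\<lambda>u v. of_bool ({u, v} \<in> cayley_edges G S) / real d) (cayley_lambda G S)"
    unfolding cayley_lambda_def
  proof (rule regular_graph_gap_kernel[OF fin _ d(2)])
    show "carrier G \<noteq> {}" by (rule carrier_not_empty)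
    show "degree_in (carrier G) (cayley_edges G S) u = d" if "u \<in> carrier G" for u
      unfolding degree_in_def cayley_neighbours[OF S that]
      using card_image[OF inj_on_translation[OF S(1) that]] d by simp
  qed
  assume u: "u \<in> carrier G"
  have "(\<Sum>v\<in>carrier G. of_bool ({u, v} \<in> cayley_edges G S) / real d * f v)
      = (\<Sum>v | v \<in> carrier G \<and> {u, v} \<in> cayley_edges G S. f v) / d"
    unfolding sum_divide_distrib using fin by (intro sum.mono_neutral_cong_right) auto
  also have "\<dots> = (\<Sum>s\<in>S. f (s \<otimes> u)) / d"
    unfolding cayley_neighbours[OF S u] by (subst sum.reindex[OF inj_on_translation[OF S(1) u]]) simp
  finally show "(\<Sum>v\<in>carrier G. of_bool ({u, v} \<in> cayley_edges G S) / real d * f v)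
      = (\<Sum>s\<in>S. f (s \<otimes> u)) / d" .
qed

section \<open>The hypergraph\<close>

lemma card_2_subset_triple:
  assumes "e \<subseteq> {p, q, r}" "card e = 2"
  shows "e = {p, q} \<or> e = {p, r} \<or> e = {q, r}"
proof -
  obtain x y where "e = {x, y}" "x \<noteq> y"
    using assms(2) by (auto simp: card_2_iff)
  with assms(1) show ?thesis by auto
qed

locale cayley_hypergraph = G1: group G1 + G2: group G2 + G3: group G3 + tripartite_graph S1 S2 S3 d
  for G1 :: "('a, 'm) monoid_scheme" and G2 :: "('b, 'n) monoid_scheme" and G3 :: "('c, 'k) monoid_scheme"
    and S1 :: "'a set" and S2 :: "'b set" and S3 :: "'c set" and d +
  assumes finite_carrier: "finite (carrier G1)" "finite (carrier G2)" "finite (carrier G3)"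
    and S_subset: "S1 \<subseteq> carrier G1" "S2 \<subseteq> carrier G2" "S3 \<subseteq> carrier G3"
    and S_inv: "S1 = set_inv\<^bsub>G1\<^esub> S1" "S2 = set_inv\<^bsub>G2\<^esub> S2" "S3 = set_inv\<^bsub>G3\<^esub> S3"
    and uniform: "uniform_hypergraph 3 (carrier (G1 \<times>\<times> G2 \<times>\<times> G3)) (product_hypergraph G1 G2 G3 S1 S2 S3)"
begin

abbreviation "H \<equiv> product_hypergraph G1 G2 G3 S1 S2 S3"
abbreviation "\<Gamma> \<equiv> carrier G1 \<times> carrier G2 \<times> carrier G3"
abbreviation "X \<equiv> \<Gamma> \<times> K"

fun edge_of :: "('a \<times> 'b \<times> 'c) \<times> ('a, 'b, 'c) tripartite_edge \<Rightarrow> ('a \<times> 'b \<times> 'c) set" where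
  "edge_of ((a, b, c), Edge12 s t) = {(s \<otimes>\<^bsub>G1\<^esub> a, b, c), (a, t \<otimes>\<^bsub>G2\<^esub> b, c)}"
| "edge_of ((a, b, c), Edge13 s u) = {(s \<otimes>\<^bsub>G1\<^esub> a, b, c), (a, b, u \<otimes>\<^bsub>G3\<^esub> c)}"
| "edge_of ((a, b, c), Edge23 t u) = {(a, t \<otimes>\<^bsub>G2\<^esub> b, c), (a, b, u \<otimes>\<^bsub>G3\<^esub> c)}"

text \<open>Every edge of the skeleton lies in exactly two clouds; \<open>swap\<close> exchanges its two descriptions.\<close>

fun swap :: "('a \<times> 'b \<times> 'c) \<times> ('a, 'b, 'c) tripartite_edge \<Rightarrow> ('a \<times> 'b \<times> 'c) \<times> ('a, 'b, 'c) tripartite_edge" where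
  "swap ((a, b, c), Edge12 s t) = ((s \<otimes>\<^bsub>G1\<^esub> a, t \<otimes>\<^bsub>G2\<^esub> b, c), Edge12 (inv\<^bsub>G1\<^esub> s) (inv\<^bsub>G2\<^esub> t))"
| "swap ((a, b, c), Edge13 s u) = ((s \<otimes>\<^bsub>G1\<^esub> a, b, u \<otimes>\<^bsub>G3\<^esub> c), Edge13 (inv\<^bsub>G1\<^esub> s) (inv\<^bsub>G3\<^esub> u))"
| "swap ((a, b, c), Edge23 t u) = ((a, t \<otimes>\<^bsub>G2\<^esub> b, u \<otimes>\<^bsub>G3\<^esub> c), Edge23 (inv\<^bsub>G2\<^esub> t) (inv\<^bsub>G3\<^esub> u))"

lemma S_carrier [simp]: "s \<in> S1 \<Longrightarrow> s \<in> carrier G1" "t \<in> S2 \<Longrightarrow> t \<in> carrier G2" "u \<in> S3 \<Longrightarrow> u \<in> carrier G3"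
  using S_subset by auto

lemma S_inv_closed [simp]:
  "s \<in> S1 \<Longrightarrow> inv\<^bsub>G1\<^esub> s \<in> S1" "t \<in> S2 \<Longrightarrow> inv\<^bsub>G2\<^esub> t \<in> S2" "u \<in> S3 \<Longrightarrow> inv\<^bsub>G3\<^esub> u \<in> S3"
  using S_inv unfolding SET_INV_def by blast+

lemma inv_cancel [simp]:
  "s \<in> S1 \<Longrightarrow> a \<in> carrier G1 \<Longrightarrow> inv\<^bsub>G1\<^esub> s \<otimes>\<^bsub>G1\<^esub> (s \<otimes>\<^bsub>G1\<^esub> a) = a"
  "t \<in> S2 \<Longrightarrow> b \<in> carrier G2 \<Longrightarrow> inv\<^bsub>G2\<^esub> t \<otimes>\<^bsub>G2\<^esub> (t \<otimes>\<^bsub>G2\<^esub> b) = b"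
  "u \<in> S3 \<Longrightarrow> c \<in> carrier G3 \<Longrightarrow> inv\<^bsub>G3\<^esub> u \<otimes>\<^bsub>G3\<^esub> (u \<otimes>\<^bsub>G3\<^esub> c) = c"
  by (simp_all add: G1.m_assoc[symmetric] G2.m_assoc[symmetric] G3.m_assoc[symmetric])

lemma inv_iff [simp]:
  "s \<in> S1 \<Longrightarrow> s' \<in> S1 \<Longrightarrow> a \<in> carrier G1 \<Longrightarrow> a = s' \<otimes>\<^bsub>G1\<^esub> (s \<otimes>\<^bsub>G1\<^esub> a) \<longleftrightarrow> s' = inv\<^bsub>G1\<^esub> s"
  "t \<in> S2 \<Longrightarrow> t' \<in> S2 \<Longrightarrow> b \<in> carrier G2 \<Longrightarrow> b = t' \<otimes>\<^bsub>G2\<^esub> (t \<otimes>\<^bsub>G2\<^esub> b) \<longleftrightarrow> t' = inv\<^bsub>G2\<^esub> t"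
  "u \<in> S3 \<Longrightarrow> u' \<in> S3 \<Longrightarrow> c \<in> carrier G3 \<Longrightarrow> c = u' \<otimes>\<^bsub>G3\<^esub> (u \<otimes>\<^bsub>G3\<^esub> c) \<longleftrightarrow> u' = inv\<^bsub>G3\<^esub> u"
  using G1.right_cancel[of "s \<otimes>\<^bsub>G1\<^esub> a" s' "inv\<^bsub>G1\<^esub> s"] G2.right_cancel[of "t \<otimes>\<^bsub>G2\<^esub> b" t' "inv\<^bsub>G2\<^esub> t"]
    G3.right_cancel[of "u \<otimes>\<^bsub>G3\<^esub> c" u' "inv\<^bsub>G3\<^esub> u"]
  by (auto simp del: G1.right_cancel G2.right_cancel G3.right_cancel)

lemma inv_iff' [simp]:
  "s \<in> S1 \<Longrightarrow> s' \<in> S1 \<Longrightarrow> a \<in> carrier G1 \<Longrightarrow> s' \<otimes>\<^bsub>G1\<^esub> (s \<otimes>\<^bsub>G1\<^esub> a) = a \<longleftrightarrow> s = inv\<^bsub>G1\<^esub> s'"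
  "t \<in> S2 \<Longrightarrow> t' \<in> S2 \<Longrightarrow> b \<in> carrier G2 \<Longrightarrow> t' \<otimes>\<^bsub>G2\<^esub> (t \<otimes>\<^bsub>G2\<^esub> b) = b \<longleftrightarrow> t = inv\<^bsub>G2\<^esub> t'"
  "u \<in> S3 \<Longrightarrow> u' \<in> S3 \<Longrightarrow> c \<in> carrier G3 \<Longrightarrow> u' \<otimes>\<^bsub>G3\<^esub> (u \<otimes>\<^bsub>G3\<^esub> c) = c \<longleftrightarrow> u = inv\<^bsub>G3\<^esub> u'"
  using inv_iff G1.inv_inv[of s] G1.inv_inv[of s'] G2.inv_inv[of t] G2.inv_inv[of t'] G3.inv_inv[of u] G3.inv_inv[of u']
  by (metis S_carrier)+

lemma H_eq: "H = {{(s \<otimes>\<^bsub>G1\<^esub> a, b, c), (a, t \<otimes>\<^bsub>G2\<^esub> b, c), (a, b, u \<otimes>\<^bsub>G3\<^esub> c)} | a b c s t u.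
    (a, b, c) \<in> \<Gamma> \<and> s \<in> S1 \<and> t \<in> S2 \<and> u \<in> S3}"
proof -
  have "{(s, \<one>\<^bsub>G2\<^esub>, \<one>\<^bsub>G3\<^esub>) \<otimes>\<^bsub>G1 \<times>\<times> G2 \<times>\<times> G3\<^esub> (a, b, c),
       (\<one>\<^bsub>G1\<^esub>, t, \<one>\<^bsub>G3\<^esub>) \<otimes>\<^bsub>G1 \<times>\<times> G2 \<times>\<times> G3\<^esub> (a, b, c),
       (\<one>\<^bsub>G1\<^esub>, \<one>\<^bsub>G2\<^esub>, u) \<otimes>\<^bsub>G1 \<times>\<times> G2 \<times>\<times> G3\<^esub> (a, b, c)}
      = {(s \<otimes>\<^bsub>G1\<^esub> a, b, c), (a, t \<otimes>\<^bsub>G2\<^esub> b, c), (a, b, u \<otimes>\<^bsub>G3\<^esub> c)}" if "(a, b, c) \<in> \<Gamma>" for a b c s t u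
    using that by simp
  note eq = this
  show ?thesis
    unfolding product_hypergraph_def carrier_DirProd split_paired_Ex
    by (intro Collect_cong ex_cong1 iffI; elim conjE; simp only: eq simp_thms)
qed

lemma parts_nonempty: "S1 \<noteq> {}" "S2 \<noteq> {}" "S3 \<noteq> {}"
  using card_S card_T card_U d_pos by auto

text \<open>In a triple built at the identity element of the product, two identities among s, t, u
  would make two of its three points coincide, against 3-uniformity.\<close>

lemma one_at_most_once:
  "\<not> (\<one>\<^bsub>G1\<^esub> \<in> S1 \<and> \<one>\<^bsub>G2\<^esub> \<in> S2)" "\<not> (\<one>\<^bsub>G1\<^esub> \<in> S1 \<and> \<one>\<^bsub>G3\<^esub> \<in> S3)" "\<not> (\<one>\<^bsub>G2\<^esub> \<in> S2 \<and> \<one>\<^bsub>G3\<^esub> \<in> S3)"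
proof -
  obtain s t u where stu: "s \<in> S1" "t \<in> S2" "u \<in> S3"
    using parts_nonempty by blast
  have card3: "card {(s, \<one>\<^bsub>G2\<^esub>, \<one>\<^bsub>G3\<^esub>), (\<one>\<^bsub>G1\<^esub>, t, \<one>\<^bsub>G3\<^esub>), (\<one>\<^bsub>G1\<^esub>, \<one>\<^bsub>G2\<^esub>, u)} = 3"
    if "s \<in> S1" "t \<in> S2" "u \<in> S3" for s t u
  proof -
    have "{(s \<otimes>\<^bsub>G1\<^esub> \<one>\<^bsub>G1\<^esub>, \<one>\<^bsub>G2\<^esub>, \<one>\<^bsub>G3\<^esub>), (\<one>\<^bsub>G1\<^esub>, t \<otimes>\<^bsub>G2\<^esub> \<one>\<^bsub>G2\<^esub>, \<one>\<^bsub>G3\<^esub>), (\<one>\<^bsub>G1\<^esub>, \<one>\<^bsub>G2\<^esub>, u \<otimes>\<^bsub>G3\<^esub> \<one>\<^bsub>G3\<^esub>)} \<in> H"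
      unfolding H_eq using that by blast
    then show ?thesis
      using uniform that by (simp add: uniform_hypergraph_def)
  qed
  have two: "card {p, q} \<noteq> 3" for p q :: "'a \<times> 'b \<times> 'c"
    by (cases "p = q") auto
  show "\<not> (\<one>\<^bsub>G1\<^esub> \<in> S1 \<and> \<one>\<^bsub>G2\<^esub> \<in> S2)"
    using card3[of "\<one>\<^bsub>G1\<^esub>" "\<one>\<^bsub>G2\<^esub>" u] stu two by auto
  show "\<not> (\<one>\<^bsub>G1\<^esub> \<in> S1 \<and> \<one>\<^bsub>G3\<^esub> \<in> S3)"
    using card3[of "\<one>\<^bsub>G1\<^esub>" t "\<one>\<^bsub>G3\<^esub>"] stu two by (auto simp: insert_commute)
  show "\<not> (\<one>\<^bsub>G2\<^esub> \<in> S2 \<and> \<one>\<^bsub>G3\<^esub> \<in> S3)"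
    using card3[of s "\<one>\<^bsub>G2\<^esub>" "\<one>\<^bsub>G3\<^esub>"] stu two by auto
qed

section \<open>The two descriptions of a skeleton edge\<close>

lemma swap_closed: "z \<in> X \<Longrightarrow> swap z \<in> X"
  by (cases z rule: swap.cases) auto

lemma swap_swap: "z \<in> X \<Longrightarrow> swap (swap z) = z"
  by (cases z rule: swap.cases) auto

lemma edge_of_swap: "z \<in> X \<Longrightarrow> edge_of (swap z) = edge_of z"
  by (cases z rule: swap.cases) (auto simp: insert_commute)

lemma fst_swap_neq: "z \<in> X \<Longrightarrow> fst (swap z) \<noteq> fst z"
  using one_at_most_once by (cases z rule: swap.cases) auto

text \<open>Linked edges share one translated coordinate. Their swaps reach the same cloud only if
  the translations in the other two coordinates are both trivial, for instance t and u for
  \<open>Edge12 s t\<close> and \<open>Edge13 s u\<close>; two identities are excluded.\<close>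

lemma fst_swap_linked:
  assumes "(g, k) \<in> X" "(g, k') \<in> X" "linked k k'"
  shows "fst (swap (g, k)) \<noteq> fst (swap (g, k'))"
  using assms one_at_most_once by (cases g; cases k; cases k') auto

text \<open>Edges of different classes coincide only if two of the sets contain the identity:
  \<open>Edge12 s t\<close> and \<open>Edge13 s' u\<close> would need t and u trivial. Within one
  class, matching the endpoints in order returns the same description, and matching them crosswise
  gives the swapped one.\<close>

lemma edge_of_eq:
  assumes "z \<in> X" "z' \<in> X" "edge_of z = edge_of z'"
  shows "z' = z \<or> z' = swap z"
proof (cases z rule: swap.cases)
  case (1 a b c s t)
  with assms one_at_most_once show ?thesis
    by (cases z' rule: swap.cases) (auto simp: doubleton_eq_iff)
next
  case (2 a b c s u)
  with assms one_at_most_once show ?thesis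
    by (cases z' rule: swap.cases) (auto simp: doubleton_eq_iff)
next
  case (3 a b c t u)
  with assms one_at_most_once show ?thesis
    by (cases z' rule: swap.cases) (auto simp: doubleton_eq_iff)
qed

lemma card_edge_of: "z \<in> X \<Longrightarrow> card (edge_of z) = 2"
  using one_at_most_once by (cases z rule: swap.cases) (auto simp: card_insert_if)

lemma linked_in_triple:
  assumes "(g, k) \<in> X" "(g, k') \<in> X" "linked k k'"
  shows "\<exists>T\<in>H. edge_of (g, k) \<union> edge_of (g, k') \<subseteq> T"
proof -
  obtain a b c where g: "g = (a, b, c)" by (cases g)
  have triple: "\<exists>T\<in>H. e \<subseteq> T"
    if "s \<in> S1" "t \<in> S2" "u \<in> S3"
      "e \<subseteq> {(s \<otimes>\<^bsub>G1\<^esub> a, b, c), (a, t \<otimes>\<^bsub>G2\<^esub> b, c), (a, b, u \<otimes>\<^bsub>G3\<^esub> c)}" for s t u e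
  proof (rule bexI)
    show "e \<subseteq> {(s \<otimes>\<^bsub>G1\<^esub> a, b, c), (a, t \<otimes>\<^bsub>G2\<^esub> b, c), (a, b, u \<otimes>\<^bsub>G3\<^esub> c)}"
      by fact
    show "{(s \<otimes>\<^bsub>G1\<^esub> a, b, c), (a, t \<otimes>\<^bsub>G2\<^esub> b, c), (a, b, u \<otimes>\<^bsub>G3\<^esub> c)} \<in> H"
      unfolding H_eq mem_Collect_eq using that(1-3) assms(1) g
      by (intro exI[of _ a] exI[of _ b] exI[of _ c] exI[of _ s] exI[of _ t] exI[of _ u]) simp
  qed
  show ?thesis
  proof (cases k)
    case k: (Edge12 s t)
    show ?thesis
    proof (cases k')
      case (Edge13 s' u)
      with k g assms show ?thesis by (intro triple[of s t u]) auto
    next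
      case (Edge23 t' u)
      with k g assms show ?thesis by (intro triple[of s t u]) auto
    qed (use k assms in auto)
  next
    case k: (Edge13 s u)
    show ?thesis
    proof (cases k')
      case (Edge12 s' t)
      with k g assms show ?thesis by (intro triple[of s t u]) auto
    next
      case (Edge23 t u')
      with k g assms show ?thesis by (intro triple[of s t u]) auto
    qed (use k assms in auto)
  next
    case k: (Edge23 t u)
    show ?thesis
    proof (cases k')
      case (Edge12 s t')
      with k g assms show ?thesis by (intro triple[of s t u]) auto
    next
      case (Edge13 s u')
      with k g assms show ?thesis by (intro triple[of s t u]) auto
    qed (use k assms in auto)
  qed
qed

lemma edge_of_in_skeleton:
  assumes "z \<in> X"
  shows "edge_of z \<in> skeleton H"
proof -
  obtain g k where z: "z = (g, k)" by (cases z)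
  have "\<exists>k'. k' \<in> K \<and> linked k k'"
  proof -
    obtain s0 t0 u0 where "s0 \<in> S1" "t0 \<in> S2" "u0 \<in> S3"
      using parts_nonempty by blast
    then show ?thesis
      using assms unfolding z
      by (intro exI[of _ "case k of Edge12 s t \<Rightarrow> Edge13 s u0 | Edge13 s u \<Rightarrow> Edge12 s t0 | Edge23 t u \<Rightarrow> Edge12 s0 t"])
        (cases k, auto)
  qed
  then obtain k' where "(g, k') \<in> X" "linked k k'"
    using assms z by auto
  then show ?thesis
    using linked_in_triple[of g k k'] card_edge_of[OF assms] assms z unfolding skeleton_def by auto
qed

text \<open>A triple is a triangle of one cloud, and any two distinct sides of a triangle are
  linked; so adjacency in the walk is always witnessed inside a single cloud.\<close>

lemma two_edges_in_triple:
  assumes "T \<in> H" "e \<subseteq> T" "card e = 2" "e' \<subseteq> T" "card e' = 2" "e \<noteq> e'"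
  obtains g k k' where "(g, k) \<in> X" "(g, k') \<in> X" "linked k k'" "e = edge_of (g, k)" "e' = edge_of (g, k')"
proof -
  obtain a b c s t u where g: "(a, b, c) \<in> \<Gamma>" and stu: "s \<in> S1" "t \<in> S2" "u \<in> S3"
    and T: "T = {(s \<otimes>\<^bsub>G1\<^esub> a, b, c), (a, t \<otimes>\<^bsub>G2\<^esub> b, c), (a, b, u \<otimes>\<^bsub>G3\<^esub> c)}"
    using assms(1) unfolding H_eq by blast
  define \<Delta> where "\<Delta> = {Edge12 s t, Edge13 s u, Edge23 t u}"
  have "\<exists>k\<in>\<Delta>. f = edge_of ((a, b, c), k)" if "f \<subseteq> T" "card f = 2" for f
    using card_2_subset_triple[OF that(1)[unfolded T] that(2)] unfolding \<Delta>_def by simp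
  note edge = this
  obtain k where k: "k \<in> \<Delta>" "e = edge_of ((a, b, c), k)"
    using edge[OF assms(2,3)] by blast
  obtain k' where k': "k' \<in> \<Delta>" "e' = edge_of ((a, b, c), k')"
    using edge[OF assms(4,5)] by blast
  have "k \<noteq> k'"
    using k(2) k'(2) assms(6) by blast
  then have "linked k k'"
    using k(1) k'(1) unfolding \<Delta>_def by auto
  moreover have "((a, b, c), k) \<in> X" "((a, b, c), k') \<in> X"
    using k(1) k'(1) g stu unfolding \<Delta>_def by auto
  ultimately show ?thesis
    using that[OF _ _ _ k(2) k'(2)] by blast
qed

lemma skeleton_eq: "skeleton H = edge_of ` X"
proof (intro equalityI subsetI)
  fix e assume "e \<in> skeleton H"
  then obtain T where T: "T \<in> H" "e \<subseteq> T" "card e = 2"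
    unfolding skeleton_def by blast
  \<comment> \<open>A second pair in the same triple is produced so that
    \<open>two_edges_in_triple\<close> applies to \<open>e\<close>.\<close>
  have "card T = 3"
    using uniform T(1) by (simp add: uniform_hypergraph_def)
  then have "T \<noteq> e"
    using T(3) by auto
  then obtain x where x: "x \<in> T" "x \<notin> e"
    using T(2) by blast
  have "e \<noteq> {}"
    using T(3) by auto
  then obtain y where y: "y \<in> e"
    by blast
  then have "x \<noteq> y"
    using x by blast
  then have "card {x, y} = 2" "{x, y} \<subseteq> T" "{x, y} \<noteq> e"
    using x y T(2) by auto
  then show "e \<in> edge_of ` X"
    using two_edges_in_triple[OF T, of "{x, y}"] by blast
qed (auto simp: edge_of_in_skeleton)

lemma walk_edges_iff:
  assumes "e \<in> skeleton H" "e' \<in> skeleton H"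
  shows "{e, e'} \<in> walk_edges H \<longleftrightarrow> e \<noteq> e' \<and> (\<exists>T\<in>H. e \<union> e' \<subseteq> T)"
proof
  assume "{e, e'} \<in> walk_edges H"
  then obtain f f' T where f: "{e, e'} = {f, f'}" "f \<noteq> f'" and T: "T \<in> H" "f \<union> f' \<subseteq> T"
    unfolding walk_edges_def mem_Collect_eq by (elim exE conjE bexE) (rule that)
  from f have "e \<noteq> e'" "e \<union> e' = f \<union> f'"
    unfolding doubleton_eq_iff by (elim disjE conjE; simp add: Un_commute)+
  with T show "e \<noteq> e' \<and> (\<exists>T\<in>H. e \<union> e' \<subseteq> T)"
    by (intro conjI bexI[of _ T]) simp_all
next
  assume "e \<noteq> e' \<and> (\<exists>T\<in>H. e \<union> e' \<subseteq> T)"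
  with assms show "{e, e'} \<in> walk_edges H"
    unfolding walk_edges_def mem_Collect_eq by (intro exI[of _ e] exI[of _ e'] conjI refl) simp_all
qed

section \<open>The skeleton walk on pairs of cloud and edge\<close>

definition nbrs :: "('a \<times> 'b \<times> 'c) \<times> ('a, 'b, 'c) tripartite_edge \<Rightarrow> (('a \<times> 'b \<times> 'c) \<times> ('a, 'b, 'c) tripartite_edge) set" where
  "nbrs z = {fst z} \<times> {k \<in> K. linked (snd z) k}"

lemma nbrs_subset: "z \<in> X \<Longrightarrow> nbrs z \<subseteq> X"
  unfolding nbrs_def by auto

lemma edge_of_nbrs_adjacent:
  assumes "z \<in> X" "y \<in> nbrs z"
  shows "{edge_of z, edge_of y} \<in> walk_edges H"
proof -
  obtain g k where z: "z = (g, k)" by (cases z)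
  then obtain k' where y: "y = (g, k')" "linked k k'" "y \<in> X"
    using assms nbrs_subset unfolding nbrs_def by auto
  have "edge_of z \<noteq> edge_of y"
  proof
    assume "edge_of z = edge_of y"
    then have "y = z \<or> y = swap z"
      using edge_of_eq[OF assms(1)] y(3) by blast
    moreover have "y \<noteq> z"
      using y z by (cases k; cases k') auto
    moreover have "y \<noteq> swap z"
      using fst_swap_neq[OF assms(1)] y(1) z by (metis fst_conv)
    ultimately show False by blast
  qed
  then show ?thesis
    using linked_in_triple[of g k k'] assms(1) y z edge_of_in_skeleton by (simp add: walk_edges_iff)
qed

text \<open>A common triple places both edges in one cloud, and by \<open>edge_of_eq\<close> this
  cloud is one of the two that contain \<open>edge_of z\<close>.\<close>

lemma walk_neighbours:
  assumes z: "z \<in> X"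
  shows "{e'. e' \<in> skeleton H \<and> {edge_of z, e'} \<in> walk_edges H} = edge_of ` (nbrs z \<union> nbrs (swap z))"
proof (intro equalityI subsetI)
  fix e' assume "e' \<in> {e'. e' \<in> skeleton H \<and> {edge_of z, e'} \<in> walk_edges H}"
  then have e': "e' \<in> skeleton H" "{edge_of z, e'} \<in> walk_edges H" by auto
  then obtain T where T: "T \<in> H" "edge_of z \<subseteq> T" "e' \<subseteq> T" "edge_of z \<noteq> e'"
    using walk_edges_iff[OF edge_of_in_skeleton[OF z] e'(1)] by blast
  have "card e' = 2"
    using e'(1) by (simp add: skeleton_def)
  then obtain g k k' where k: "(g, k) \<in> X" "(g, k') \<in> X" "linked k k'"
    "edge_of z = edge_of (g, k)" "e' = edge_of (g, k')"
    using two_edges_in_triple[OF T(1,2) card_edge_of[OF z] T(3) _ T(4)] by blast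
  have "(g, k') \<in> nbrs (g, k)"
    using k by (auto simp: nbrs_def)
  moreover have "(g, k) = z \<or> (g, k) = swap z"
    using edge_of_eq[OF z k(1,4)] .
  ultimately show "e' \<in> edge_of ` (nbrs z \<union> nbrs (swap z))"
    using k(5) by auto
next
  fix e' assume "e' \<in> edge_of ` (nbrs z \<union> nbrs (swap z))"
  then obtain y where y: "e' = edge_of y" "y \<in> nbrs z \<union> nbrs (swap z)" by blast
  have "y \<in> X"
    using y(2) nbrs_subset z swap_closed by blast
  moreover have "{edge_of z, e'} \<in> walk_edges H"
    using y edge_of_nbrs_adjacent[OF z, of y] edge_of_nbrs_adjacent[OF swap_closed[OF z], of y] edge_of_swap[OF z] by auto
  ultimately show "e' \<in> {e'. e' \<in> skeleton H \<and> {edge_of z, e'} \<in> walk_edges H}"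
    using y(1) edge_of_in_skeleton by blast
qed

lemma nbrs_disjoint: "z \<in> X \<Longrightarrow> nbrs z \<inter> nbrs (swap z) = {}"
  using fst_swap_neq[of z] unfolding nbrs_def by auto

text \<open>Different descriptions of one edge are swaps of each other and lie in different clouds.
  A coincidence would thus swap a neighbour of z into the cloud of \<open>swap z\<close>, which
  \<open>fst_swap_linked\<close> forbids because z itself swaps there.\<close>

lemma inj_on_edge_of:
  assumes z: "z \<in> X"
  shows "inj_on edge_of (nbrs z \<union> nbrs (swap z))"
proof -
  have same: "y = y'" if "w \<in> X" "y \<in> nbrs w" "y' \<in> nbrs w" "edge_of y = edge_of y'" for w y y'
  proof -
    have "y \<in> X" "y' \<in> X"
      using that nbrs_subset by blast+
    moreover have "fst y' = fst y"
      using that by (simp add: nbrs_def mem_Times_iff)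
    ultimately show ?thesis
      using edge_of_eq[of y y'] fst_swap_neq[of y] that(4) by metis
  qed
  have diff: "edge_of y \<noteq> edge_of y'" if y: "y \<in> nbrs z" "y' \<in> nbrs (swap z)" for y y'
  proof
    assume eq: "edge_of y = edge_of y'"
    have X: "y \<in> X" "y' \<in> X"
      using that nbrs_subset z swap_closed by blast+
    obtain g k where zgk: "z = (g, k)" by (cases z)
    obtain k' where k': "y = (g, k')" "linked k k'"
      using y(1) unfolding nbrs_def zgk by auto
    have fst_y': "fst y' = fst (swap z)"
      using y(2) by (simp add: nbrs_def mem_Times_iff)
    have "y' \<noteq> y"
      using nbrs_disjoint[OF z] y by blast
    then have "y' = swap y"
      using edge_of_eq[OF X eq] by blast
    then show False
      using fst_swap_linked[of g k k'] fst_y' z X(1) k' zgk by metis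
  qed
  show ?thesis
  proof (rule inj_onI)
    fix y y' assume *: "y \<in> nbrs z \<union> nbrs (swap z)" "y' \<in> nbrs z \<union> nbrs (swap z)" "edge_of y = edge_of y'"
    then consider "y \<in> nbrs z" "y' \<in> nbrs z" | "y \<in> nbrs (swap z)" "y' \<in> nbrs (swap z)"
      | "y \<in> nbrs z" "y' \<in> nbrs (swap z)" | "y' \<in> nbrs z" "y \<in> nbrs (swap z)"
      by blast
    then show "y = y'"
      using same[OF z _ _ *(3)] same[OF swap_closed[OF z] _ _ *(3)] diff *(3) by cases metis+
  qed
qed

lemma sum_nbrs:
  fixes F :: "('a \<times> 'b \<times> 'c) \<times> ('a, 'b, 'c) tripartite_edge \<Rightarrow> real"
  shows "sum F (nbrs z) = 2 * d * (\<Sum>k\<in>K. N (snd z) k * F (fst z, k))"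
proof -
  have "sum F (nbrs z) = (\<Sum>k | k \<in> K \<and> linked (snd z) k. F (fst z, k))"
  proof -
    have "nbrs z = Pair (fst z) ` {k \<in> K. linked (snd z) k}"
      unfolding nbrs_def by blast
    then show ?thesis
      by (simp add: sum.reindex inj_on_def)
  qed
  also have "\<dots> = (\<Sum>k\<in>K. 2 * d * (N (snd z) k * F (fst z, k)))"
    using finite_K d_pos by (intro sum.mono_neutral_cong_left) (auto simp: N_def)
  finally show ?thesis by (simp add: sum_distrib_left)
qed

lemma finite_X: "finite X"
  using finite_carrier finite_K by simp

text \<open>In the notation P, M of the overview, the right-hand side is 4 d times P M applied to
  the lifted function \<open>h (edge_of z)\<close>, which P fixes.\<close>

lemma sum_walk_neighbours:
  fixes h :: "('a \<times> 'b \<times> 'c) set \<Rightarrow> real"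
  assumes z: "z \<in> X"
  shows "(\<Sum>e' | e' \<in> skeleton H \<and> {edge_of z, e'} \<in> walk_edges H. h e')
    = 2 * d * ((\<Sum>k\<in>K. N (snd z) k * h (edge_of (fst z, k)))
        + (\<Sum>k\<in>K. N (snd (swap z)) k * h (edge_of (fst (swap z), k))))"
proof -
  have fin: "finite (nbrs z)" "finite (nbrs (swap z))"
    by (rule finite_subset[OF nbrs_subset finite_X], intro z swap_closed)+
  have "(\<Sum>e' | e' \<in> skeleton H \<and> {edge_of z, e'} \<in> walk_edges H. h e')
      = (\<Sum>y\<in>nbrs z \<union> nbrs (swap z). h (edge_of y))"
    unfolding walk_neighbours[OF z] sum.reindex[OF inj_on_edge_of[OF z]] comp_def ..
  also have "\<dots> = (\<Sum>y\<in>nbrs z. h (edge_of y)) + (\<Sum>y\<in>nbrs (swap z). h (edge_of y))"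
    by (rule sum.union_disjoint[OF fin nbrs_disjoint[OF z]])
  finally show ?thesis
    unfolding sum_nbrs by (simp only: distrib_left)
qed

lemma walk_degree:
  assumes "e \<in> skeleton H"
  shows "degree_in (skeleton H) (walk_edges H) e = 4 * d"
proof -
  obtain z where z: "z \<in> X" "e = edge_of z"
    using assms[unfolded skeleton_eq] by blast
  have "snd z \<in> K" "snd (swap z) \<in> K"
    using z(1) swap_closed[OF z(1)] by (simp_all add: mem_Times_iff)
  then have "real (degree_in (skeleton H) (walk_edges H) e) = real (4 * d)"
    using sum_walk_neighbours[OF z(1), of "\<lambda>_. 1"] unfolding degree_in_def z(2) mult_1_right
    by (simp only: N_row sum_constant) simp
  then show ?thesis by linarith
qed

lemma sum_edge_of:
  fixes h :: "('a \<times> 'b \<times> 'c) set \<Rightarrow> real"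
  shows "(\<Sum>z\<in>X. h (edge_of z)) = 2 * sum h (skeleton H)"
proof -
  have "(\<Sum>z | z \<in> X \<and> edge_of z = e. h (edge_of z)) = 2 * h e" if e: "e \<in> edge_of ` X" for e
  proof -
    obtain z where z: "z \<in> X" "e = edge_of z"
      using e by blast
    have "{z' \<in> X. edge_of z' = e} = {z, swap z}"
    proof (intro equalityI subsetI)
      fix z' assume "z' \<in> {z' \<in> X. edge_of z' = e}"
      then have "z' \<in> X" "edge_of z = edge_of z'"
        using z(2) by simp_all
      then show "z' \<in> {z, swap z}"
        using edge_of_eq[OF z(1)] by simp
    next
      fix z' assume "z' \<in> {z, swap z}"
      then show "z' \<in> {z' \<in> X. edge_of z' = e}"
        using z edge_of_swap[OF z(1)] swap_closed[OF z(1)] by (elim insertE) simp_all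
    qed
    moreover have "z \<noteq> swap z"
      using fst_swap_neq[OF z(1)] by metis
    ultimately show ?thesis
      using edge_of_swap[OF z(1)] z(2) by simp
  qed
  then show ?thesis
    unfolding skeleton_eq sum.image_gen[OF finite_X, of "\<lambda>z. h (edge_of z)" edge_of] sum_distrib_left
    by (intro sum.cong refl)
qed

text \<open>The three edge classes of a cloud lead to the clouds averaged by L1 L2, L1 L3 and L2 L3,
  with d^2 edges each. The form is therefore d^2 times \<open>pair_form\<close>, and the denominator
  3 comes from |K| = 3 d^2.\<close>

lemma cloud_graph_form_le:
  assumes \<lambda>: "cayley_lambda G1 S1 \<le> c" "cayley_lambda G2 S2 \<le> c" "cayley_lambda G3 S3 \<le> c"
    and \<phi>: "sum \<phi> \<Gamma> = 0"
  shows "(\<Sum>z\<in>X. \<phi> (fst z) * \<phi> (fst (swap z))) \<le> (1 + 2 * c) / 3 * (real (card K) * (\<Sum>g\<in>\<Gamma>. (\<phi> g)\<^sup>2))"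
proof -
  have nonneg: "0 \<le> cayley_lambda G1 S1" "0 \<le> cayley_lambda G2 S2" "0 \<le> cayley_lambda G3 S3"
    unfolding cayley_lambda_def by (intro graph_lambda_nonneg)+
  define k1 where "k1 u v = of_bool ({u, v} \<in> cayley_edges G1 S1) / real d" for u v
  define k2 where "k2 u v = of_bool ({u, v} \<in> cayley_edges G2 S2) / real d" for u v
  define k3 where "k3 u v = of_bool ({u, v} \<in> cayley_edges G3 S3) / real d" for u v
  note kern1 = G1.cayley_gap_kernel[OF finite_carrier(1) S_subset(1) S_inv(1) card_S d_pos]
  note kern2 = G2.cayley_gap_kernel[OF finite_carrier(2) S_subset(2) S_inv(2) card_T d_pos]
  note kern3 = G3.cayley_gap_kernel[OF finite_carrier(3) S_subset(3) S_inv(3) card_U d_pos]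
  interpret three_gap_kernels "carrier G1" "carrier G2" "carrier G3" k1 k2 k3 c
  proof (intro three_gap_kernels.intro three_gap_kernels_axioms.intro)
    show "gap_kernel (carrier G1) k1 c"
      unfolding k1_def[abs_def] by (rule gap_kernel_mono[OF kern1(1) nonneg(1) \<lambda>(1)])
    show "gap_kernel (carrier G2) k2 c"
      unfolding k2_def[abs_def] by (rule gap_kernel_mono[OF kern2(1) nonneg(2) \<lambda>(2)])
    show "gap_kernel (carrier G3) k3 c"
      unfolding k3_def[abs_def] by (rule gap_kernel_mono[OF kern3(1) nonneg(3) \<lambda>(3)])
    show "0 \<le> c" using nonneg \<lambda> by linarith
  qed
  have L: "L1 \<psi> (a, b, c) = (\<Sum>s\<in>S1. \<psi> (s \<otimes>\<^bsub>G1\<^esub> a, b, c)) / d"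
    "L2 \<psi> (a, b, c) = (\<Sum>t\<in>S2. \<psi> (a, t \<otimes>\<^bsub>G2\<^esub> b, c)) / d"
    "L3 \<psi> (a, b, c) = (\<Sum>u\<in>S3. \<psi> (a, b, u \<otimes>\<^bsub>G3\<^esub> c)) / d"
    if "(a, b, c) \<in> \<Gamma>" for \<psi> :: "'a \<times> 'b \<times> 'c \<Rightarrow> real" and a b c
    using that unfolding L1_def L2_def L3_def k1_def k2_def k3_def case_prod_conv mem_Times_iff fst_conv snd_conv
    by (simp_all only: kern1(2) kern2(2) kern3(2))
  have cloud: "(\<Sum>k\<in>K. \<phi> (fst (swap (g, k)))) = (real d)\<^sup>2 * (L1 (L2 \<phi>) g + L1 (L3 \<phi>) g + L2 (L3 \<phi>) g)"
    if "g \<in> \<Gamma>" for g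
  proof -
    obtain a b c where g: "g = (a, b, c)" by (cases g)
    have abc: "(a, b, c) \<in> \<Gamma>" using that g by simp
    have "d\<^sup>2 * L1 (L2 \<phi>) (a, b, c) = (\<Sum>s\<in>S1. \<Sum>t\<in>S2. \<phi> (s \<otimes>\<^bsub>G1\<^esub> a, t \<otimes>\<^bsub>G2\<^esub> b, c))"
      "d\<^sup>2 * L1 (L3 \<phi>) (a, b, c) = (\<Sum>s\<in>S1. \<Sum>u\<in>S3. \<phi> (s \<otimes>\<^bsub>G1\<^esub> a, b, u \<otimes>\<^bsub>G3\<^esub> c))"
      "d\<^sup>2 * L2 (L3 \<phi>) (a, b, c) = (\<Sum>t\<in>S2. \<Sum>u\<in>S3. \<phi> (a, t \<otimes>\<^bsub>G2\<^esub> b, u \<otimes>\<^bsub>G3\<^esub> c))"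
      using abc d_pos by (simp_all add: L power2_eq_square sum_divide_distrib[symmetric])
    then show ?thesis
      unfolding g sum_K by (simp add: distrib_left)
  qed
  have "(\<Sum>z\<in>X. \<phi> (fst z) * \<phi> (fst (swap z))) = (\<Sum>g\<in>\<Gamma>. \<phi> g * (\<Sum>k\<in>K. \<phi> (fst (swap (g, k)))))"
    unfolding sum_distrib_left by (simp add: sum.cartesian_product case_prod_unfold)
  also have "\<dots> = (\<Sum>g\<in>\<Gamma>. (real d)\<^sup>2 * (\<phi> g * L1 (L2 \<phi>) g + \<phi> g * L1 (L3 \<phi>) g + \<phi> g * L2 (L3 \<phi>) g))"
    by (intro sum.cong refl) (simp only: cloud, simp add: algebra_simps)
  also have "\<dots> = (real d)\<^sup>2 * pair_form \<phi>"
    unfolding pair_form_def L_selfadjoint[symmetric] by (simp add: sum_distrib_left[symmetric] sum.distrib)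
  also have "\<dots> \<le> (real d)\<^sup>2 * ((1 + 2 * c) * (\<Sum>g\<in>\<Gamma>. (\<phi> g)\<^sup>2))"
    using pair_form_le[OF \<phi>] by (intro mult_left_mono) auto
  finally show ?thesis
    unfolding card_K by (simp add: algebra_simps)
qed

text \<open>An eigenfunction of the skeleton walk is lifted along \<open>edge_of\<close>; every edge
  has two descriptions, so sum zero survives. Degree 4 d against the factor 2 d of
  \<open>sum_walk_neighbours\<close> leaves the 2 \<mu> of the abstract eigenvalue equation.\<close>

lemma walk_lambda_le:
  assumes \<lambda>: "cayley_lambda G1 S1 \<le> c" "cayley_lambda G2 S2 \<le> c" "cayley_lambda G3 S3 \<le> c"
  shows "walk_lambda H \<le> sqrt (1 / 2 + 1 / 2 * zigzag_fun ((1 + 2 * c) / 3) (1 / 2))"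
  unfolding walk_lambda_def
proof (rule graph_lambda_le)
  have c: "0 \<le> c"
    using graph_lambda_nonneg \<lambda>(1) unfolding cayley_lambda_def by (rule order_trans)
  show "finite (skeleton H)"
    unfolding skeleton_eq using finite_X by simp
  show "skeleton H \<noteq> {}"
    unfolding skeleton_eq using parts_nonempty G1.one_closed G2.one_closed G3.one_closed
    by (auto simp: tripartite_edges_def)
  show "0 < 4 * d" using d_pos by simp
  show "degree_in (skeleton H) (walk_edges H) e = 4 * d" if "e \<in> skeleton H" for e
    using that by (rule walk_degree)
  show "0 \<le> sqrt (1 / 2 + 1 / 2 * zigzag_fun ((1 + 2 * c) / 3) (1 / 2))"
    using zigzag_fun_ge[of "(1 + 2 * c) / 3" "1 / 2"] c by simp
  fix h :: "('a \<times> 'b \<times> 'c) set \<Rightarrow> real" and \<mu>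
  assume h: "\<exists>e\<in>skeleton H. h e \<noteq> 0" "sum h (skeleton H) = 0"
    and ev: "\<And>e. e \<in> skeleton H \<Longrightarrow>
      (\<Sum>e' | e' \<in> skeleton H \<and> {e, e'} \<in> walk_edges H. h e') = real (4 * d) * \<mu> * h e"
  show "\<bar>\<mu>\<bar> \<le> sqrt (1 / 2 + 1 / 2 * zigzag_fun ((1 + 2 * c) / 3) (1 / 2))"
  proof (rule half_reflected_walk_eigenvalue_le[where F = "\<lambda>z. h (edge_of z)" and N = N and \<rho> = swap
        and G = \<Gamma> and K = K and x = "(1 + 2 * c) / 3" and y = "1 / 2" and \<nu> = \<mu>])
    show "finite \<Gamma>" using finite_carrier by simp
    show "finite K" by (rule finite_K)
    show "K \<noteq> {}"
      using parts_nonempty by (auto simp: tripartite_edges_def)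
    show "(\<Sum>k'\<in>K. N k k') = 1" if "k \<in> K" for k
      by (rule N_row[OF that])
    show "(\<Sum>k\<in>K. N k k') = 1" if "k' \<in> K" for k'
      using N_row[OF that] by (simp add: N_sym[of _ k'])
    show "(\<Sum>k\<in>K. (\<Sum>k'\<in>K. N k k' * f k')\<^sup>2) \<le> (1 / 2)\<^sup>2 * (\<Sum>k\<in>K. (f k)\<^sup>2)" if "sum f K = 0" for f
      by (rule N_contraction[OF that])
    show "swap z \<in> X" "swap (swap z) = z" if "z \<in> X" for z
      using swap_closed[OF that] swap_swap[OF that] by auto
    show "(\<Sum>z\<in>X. \<phi> (fst z) * \<phi> (fst (swap z))) \<le> (1 + 2 * c) / 3 * (real (card K) * (\<Sum>g\<in>\<Gamma>. (\<phi> g)\<^sup>2))"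
      if "sum \<phi> \<Gamma> = 0" for \<phi>
      by (rule cloud_graph_form_le[OF \<lambda> that])
    show "0 \<le> (1 + 2 * c) / 3" using c by simp
    show "(\<Sum>z\<in>X. h (edge_of z)) = 0"
      using h(2) by (simp add: sum_edge_of)
    show "\<exists>z\<in>X. h (edge_of z) \<noteq> 0"
      using h(1) unfolding skeleton_eq by blast
    fix g k assume "g \<in> \<Gamma>" "k \<in> K"
    then have z: "(g, k) \<in> X" by blast
    define m where "m = (\<Sum>k'\<in>K. N k k' * h (edge_of (g, k')))
        + (\<Sum>k'\<in>K. N (snd (swap (g, k))) k' * h (edge_of (fst (swap (g, k)), k')))"
    have "real (4 * d) * \<mu> * h (edge_of (g, k)) = 2 * d * m"
      unfolding m_def ev[OF edge_of_in_skeleton[OF z], symmetric] sum_walk_neighbours[OF z] fst_conv snd_conv ..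
    then have "2 * \<mu> * h (edge_of (g, k)) = m"
      using d_pos by simp
    then show "2 * \<mu> * h (edge_of (g, k)) = (\<Sum>k'\<in>K. N k k' * h (edge_of (g, k')))
        + (\<Sum>k'\<in>K. N (snd (swap (g, k))) k' * h (edge_of (fst (swap (g, k)), k')))"
      unfolding m_def .
  qed simp_all
qed

end

theorem mainTheorem3:
  fixes G1 :: "('a, 'm) monoid_scheme"
    and G2 :: "('b, 'n) monoid_scheme"
    and G3 :: "('c, 'k) monoid_scheme"
    and S1 :: "'a set" and S2 :: "'b set" and S3 :: "'c set"
    and d :: nat
  assumes "group G1" "group G2" "group G3"
    and "finite (carrier G1)" "finite (carrier G2)" "finite (carrier G3)"
    and "Coset.order G1 = Coset.order G2" "Coset.order G2 = Coset.order G3"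
    and "S1 \<subseteq> carrier G1" "S2 \<subseteq> carrier G2" "S3 \<subseteq> carrier G3"
    and "S1 = set_inv\<^bsub>G1\<^esub> S1" "S2 = set_inv\<^bsub>G2\<^esub> S2" "S3 = set_inv\<^bsub>G3\<^esub> S3"
    and "card S1 = d" "card S2 = d" "card S3 = d"
    and "uniform_hypergraph 3 (carrier (G1 \<times>\<times> G2 \<times>\<times> G3)) (product_hypergraph G1 G2 G3 S1 S2 S3)"
    and "cayley_lambda G1 S1 \<le> cayley_lambda G2 S2"
    and "cayley_lambda G2 S2 \<le> cayley_lambda G3 S3"
  shows "walk_lambda (product_hypergraph G1 G2 G3 S1 S2 S3)
           \<le> sqrt (1 / 2 + 1 / 2 * zigzag_fun ((1 + 2 * cayley_lambda G3 S3) / 3) (1 / 2))"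
proof (cases "d = 0")
  \<comment> \<open>Without generators there are no triples and no skeleton; the walk then has the
    default value 0, below any square root.\<close>
  case True
  then have "S1 = {}"
    using assms(4,9,15) by (metis card_0_eq finite_subset)
  then have "skeleton (product_hypergraph G1 G2 G3 S1 S2 S3) = {}"
    by (simp add: product_hypergraph_def skeleton_def)
  then have "walk_lambda (product_hypergraph G1 G2 G3 S1 S2 S3) = 0"
    by (simp add: walk_lambda_def graph_lambda_empty)
  moreover have "0 \<le> cayley_lambda G3 S3"
    unfolding cayley_lambda_def by (rule graph_lambda_nonneg)
  ultimately show ?thesis
    using zigzag_fun_ge[of "(1 + 2 * cayley_lambda G3 S3) / 3" "1 / 2"] by simp
next
  case False
  interpret cayley_hypergraph G1 G2 G3 S1 S2 S3 d
    using assms False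
    by (intro cayley_hypergraph.intro tripartite_graph.intro cayley_hypergraph_axioms.intro) simp_all
  show ?thesis
    using assms(19,20) by (intro walk_lambda_le) auto
qed

end
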